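(* Let $\mathcal{C}$ be a finitely generated category. Every context-free language of arrows of $\mathcal{C}$ is the functorial image of the intersection of a $\mathcal{C}$-chromatic context-free tree contour language with a regular language. That is: for every context-free language of arrows $L\subseteq\mathcal{C}(A,B)$ there exist a finite species $\mathcal{R}$ whose set of colors is $\mathrm{Ob}(\mathcal{C})\times\mathrm{Ob}(\mathcal{C})$, a color $S'$ of $\mathcal{R}$, a non-deterministic finite state automaton $M$ over the contour category $\mathcal{C}[\mathcal{R}]$, and a functor $q:\mathcal{C}[\mathcal{R}]\to\mathcal{C}$ such that $$L = q\bigl(L_{\mathcal{R},S'}\cap L_M\bigr),$$ where $L_{\mathcal{R},S'}$ is the tree contour language of the pointed species $(\mathcal{R},S')$ and $L_M$ is the regular language of arrows recognized by $M$.
   Context: Composition of arrows in categories is written in diagrammatic order ($uv$ is $u$ followed by $v$). A category is finitely generated if it has finitely many objects and its arrows are generated under composition by finitely many arrows. "Operad" means colored non-symmetric operad (multicategory); a functor of operads maps colors to colors and operations to operations, preserving arities, types, identities and composition. A constant is an operation of arity $0$; $\alpha:S$ means $\alpha$ is a constant with output color $S$. Species. A species $\mathcal{S}$ consists of a set $C$ of colors, a set $V$ of nodes, and functions $i:V\to C^*$ (list of input colors), $o:V\to C$ (output color); write $x:R_1,\dots,R_n\to R$ for a node. It is finite if $C$ and $V$ are finite. $\mathsf{Free}\,\mathcal{S}$ is the free operad on $\mathcal{S}$ (same colors, operations freely generated by the nodes). Spliced arrows. The operad $\mathcal{W}[\mathcal{C}]$ of spliced arrows of a category $\mathcal{C}$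 has as colors the pairs $(A,B)$ of objects of $\mathcal{C}$; an $n$-ary operation $(A_1,B_1),\dots,(A_n,B_n)\to(A,B)$ is a sequence $w_0{-}w_1{-}\cdots{-}w_n$ of $n+1$ arrows $w_i:B_i\to A_{i+1}$ of $\mathcal{C}$ ($0\le i\le n$, with $B_0=A$, $A_{n+1}=B$). Composition substitutes a spliced arrow for a gap "$-$", interpreting juxtaposition as composition in $\mathcal{C}$; the identity on $(A,B)$ is $\mathrm{id}_A{-}\mathrm{id}_B$. Constants of color $(A,B)$ are exactly arrows $A\to B$ of $\mathcal{C}$. Context-free languages. A context-free grammar of arrows $G=(\mathcal{C},\mathcal{S},S,p)$ consists of a finitely generated category $\mathcal{C}$, a finite species $\mathcal{S}$, a color $S$ of $\mathcal{S}$ (start symbol), and a functor of operads $p:\mathsf{Free}\,\mathcal{S}\to\mathcal{W}[\mathcal{C}]$. Its language is $L_G=\{p(\alpha)\mid \alpha:S \text{ a constant of } \mathsf{Free}\,\mathcal{S}\}\subseteq\mathcal{C}(A,B)$ where $p(S)=(A,B)$. Languages of this form are the context-free languages of arrows. The colors of $\mathcal S$ are called non-terminals. Contour category of a species. $\mathcal{C}[\mathcal{S}]$ is the free category whose objects are $R^{u}$ and $R^{d}$ for each color $R$ of $\mathcal{S}$, with one generating arrow $(x,i):R_i^{d}\to R_{i+1}^{u}$ for each node $x:R_1,\dots,R_n\to R$ of $\mathcal{S}$ and each $0\le i\le n$, under the conventions $R_0^{d}=R^{u}$ and $R_{n+1}^{u}=R^{d}$. Tree contour languages. For a finite species $\mathcal{S}$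 with color $S$, let $p_{\mathcal{S}}:\mathsf{Free}\,\mathcal{S}\to\mathcal{W}[\mathcal{C}[\mathcal{S}]]$ be the functor determined by $R\mapsto(R^u,R^d)$ and $x\mapsto(x,0){-}\cdots{-}(x,n)$ for each $n$-ary node $x$. The tree contour language $L_{\mathcal{S},S}\subseteq\mathcal{C}[\mathcal{S}](S^u,S^d)$ is the language of the grammar $(\mathcal{C}[\mathcal{S}],\mathcal{S},S,p_{\mathcal{S}})$. It is called $\mathcal{C}$-chromatic when the set of non-terminals is the set of pairs of objects of $\mathcal{C}$. Automata. A functor $p:\mathcal{Q}\to\mathcal{D}$ of categories is ULF if for every arrow $\alpha$ of $\mathcal{Q}$ with $p(\alpha)=uv$ there is a unique pair $(\beta,\gamma)$ of arrows of $\mathcal{Q}$ with $\alpha=\beta\gamma$, $p(\beta)=u$, $p(\gamma)=v$; it is finitary if $p^{-1}(A)$ and $p^{-1}(w)$ are finite for every object $A$ and arrow $w$ of $\mathcal{D}$. A non-deterministic finite state automaton over $\mathcal{D}$ is $M=(\mathcal{D},\mathcal{Q},p,q_0,q_f)$ with $p:\mathcal{Q}\to\mathcal{D}$ a finitary ULF functor and $q_0,q_f$ objects of $\mathcal{Q}$; it recognizes the regular language of arrows $L_M=\{p(\alpha)\mid\alpha:q_0\to q_f\}$. *)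

theory Defs
  imports Main
begin

section \<open>Categories\<close>

text \<open>Composition is in diagrammatic order: \<open>Comp C u v\<close> is \<open>u\<close> followed by \<open>v\<close>, for
  \<open>Cod C u = Dom C v\<close>.\<close>

record ('o, 'a) cat =
  Obj :: "'o set"
  Arr :: "'a set"
  Dom :: "'a \<Rightarrow> 'o"
  Cod :: "'a \<Rightarrow> 'o"
  Id :: "'o \<Rightarrow> 'a"
  Comp :: "'a \<Rightarrow> 'a \<Rightarrow> 'a"

locale category =
  fixes C :: "('o, 'a) cat"
  assumes Dom_in: "f \<in> Arr C \<Longrightarrow> Dom C f \<in> Obj C"
    and Cod_in: "f \<in> Arr C \<Longrightarrow> Cod C f \<in> Obj C"
    and Id_in: "A \<in> Obj C \<Longrightarrow> Id C A \<in> Arr C"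
    and Dom_Id: "A \<in> Obj C \<Longrightarrow> Dom C (Id C A) = A"
    and Cod_Id: "A \<in> Obj C \<Longrightarrow> Cod C (Id C A) = A"
    and Comp_in: "\<lbrakk>f \<in> Arr C; g \<in> Arr C; Cod C f = Dom C g\<rbrakk> \<Longrightarrow> Comp C f g \<in> Arr C"
    and Dom_Comp: "\<lbrakk>f \<in> Arr C; g \<in> Arr C; Cod C f = Dom C g\<rbrakk> \<Longrightarrow> Dom C (Comp C f g) = Dom C f"
    and Cod_Comp: "\<lbrakk>f \<in> Arr C; g \<in> Arr C; Cod C f = Dom C g\<rbrakk> \<Longrightarrow> Cod C (Comp C f g) = Cod C g"
    and Id_Comp: "f \<in> Arr C \<Longrightarrow> Comp C (Id C (Dom C f)) f = f"
    and Comp_Id: "f \<in> Arr C \<Longrightarrow> Comp C f (Id C (Cod C f)) = f"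
    and Comp_assoc: "\<lbrakk>f \<in> Arr C; g \<in> Arr C; h \<in> Arr C; Cod C f = Dom C g; Cod C g = Dom C h\<rbrakk>
      \<Longrightarrow> Comp C (Comp C f g) h = Comp C f (Comp C g h)"

definition hom :: "('o, 'a) cat \<Rightarrow> 'o \<Rightarrow> 'o \<Rightarrow> 'a set" where
  "hom C A B = {f \<in> Arr C. Dom C f = A \<and> Cod C f = B}"

text \<open>Identities are empty composites of generators.\<close>

inductive_set generated_arrows :: "('o, 'a) cat \<Rightarrow> 'a set \<Rightarrow> 'a set"
  for C :: "('o, 'a) cat" and X :: "'a set" where
  ident: "A \<in> Obj C \<Longrightarrow> Id C A \<in> generated_arrows C X"
| gen: "f \<in> X \<Longrightarrow> f \<in> generated_arrows C X"
| comp: "\<lbrakk>f \<in> generated_arrows C X; g \<in> generated_arrows C X; Cod C f = Dom C g\<rbrakk>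
    \<Longrightarrow> Comp C f g \<in> generated_arrows C X"

definition finitely_generated :: "('o, 'a) cat \<Rightarrow> bool" where
  "finitely_generated C \<longleftrightarrow>
     finite (Obj C) \<and> (\<exists>X. finite X \<and> X \<subseteq> Arr C \<and> Arr C = generated_arrows C X)"

record ('o, 'a, 'p, 'b) cat_map =
  obj_map :: "'o \<Rightarrow> 'p"
  arr_map :: "'a \<Rightarrow> 'b"

locale cat_functor = src: category C + tgt: category D
  for C :: "('o, 'a) cat" and D :: "('p, 'b) cat" and F :: "('o, 'a, 'p, 'b) cat_map" +
  assumes obj_in: "A \<in> Obj C \<Longrightarrow> obj_map F A \<in> Obj D"
    and arr_in: "f \<in> Arr C \<Longrightarrow> arr_map F f \<in> Arr D"
    and map_Dom: "f \<in> Arr C \<Longrightarrow> Dom D (arr_map F f) = obj_map F (Dom C f)"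
    and map_Cod: "f \<in> Arr C \<Longrightarrow> Cod D (arr_map F f) = obj_map F (Cod C f)"
    and map_Id: "A \<in> Obj C \<Longrightarrow> arr_map F (Id C A) = Id D (obj_map F A)"
    and map_Comp: "\<lbrakk>f \<in> Arr C; g \<in> Arr C; Cod C f = Dom C g\<rbrakk>
      \<Longrightarrow> arr_map F (Comp C f g) = Comp D (arr_map F f) (arr_map F g)"


section \<open>Colored non-symmetric operads\<close>

text \<open>\<open>Opcomp P f [g\<^sub>1, \<dots>, g\<^sub>n]\<close> plugs \<open>g\<^sub>i\<close> into the \<open>i\<close>-th input of the \<open>n\<close>-ary operation \<open>f\<close>.\<close>

record ('c, 'f) opd =
  Col :: "'c set"
  Ops :: "'f set"
  Ins :: "'f \<Rightarrow> 'c list"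
  Out :: "'f \<Rightarrow> 'c"
  Unit :: "'c \<Rightarrow> 'f"
  Opcomp :: "'f \<Rightarrow> 'f list \<Rightarrow> 'f"

definition pluggable :: "('c, 'f) opd \<Rightarrow> 'f \<Rightarrow> 'f list \<Rightarrow> bool" where
  "pluggable P f gs \<longleftrightarrow> f \<in> Ops P \<and> set gs \<subseteq> Ops P \<and> map (Out P) gs = Ins P f"

locale operad =
  fixes P :: "('c, 'f) opd"
  assumes Ins_in: "f \<in> Ops P \<Longrightarrow> set (Ins P f) \<subseteq> Col P"
    and Out_in: "f \<in> Ops P \<Longrightarrow> Out P f \<in> Col P"
    and Unit_in: "c \<in> Col P \<Longrightarrow> Unit P c \<in> Ops P"
    and Ins_Unit: "c \<in> Col P \<Longrightarrow> Ins P (Unit P c) = [c]"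
    and Out_Unit: "c \<in> Col P \<Longrightarrow> Out P (Unit P c) = c"
    and Opcomp_in: "pluggable P f gs \<Longrightarrow> Opcomp P f gs \<in> Ops P"
    and Ins_Opcomp: "pluggable P f gs \<Longrightarrow> Ins P (Opcomp P f gs) = concat (map (Ins P) gs)"
    and Out_Opcomp: "pluggable P f gs \<Longrightarrow> Out P (Opcomp P f gs) = Out P f"
    and Unit_Opcomp: "f \<in> Ops P \<Longrightarrow> Opcomp P (Unit P (Out P f)) [f] = f"
    and Opcomp_Unit: "f \<in> Ops P \<Longrightarrow> Opcomp P f (map (Unit P) (Ins P f)) = f"
    and Opcomp_assoc: "\<lbrakk>pluggable P f gs; list_all2 (pluggable P) gs hss\<rbrakk>
      \<Longrightarrow> Opcomp P (Opcomp P f gs) (concat hss) = Opcomp P f (map2 (Opcomp P) gs hss)"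

record ('c, 'f, 'd, 'g) opd_map =
  col_map :: "'c \<Rightarrow> 'd"
  op_map :: "'f \<Rightarrow> 'g"

locale operad_functor = src: operad P + tgt: operad Q
  for P :: "('c, 'f) opd" and Q :: "('d, 'g) opd" and F :: "('c, 'f, 'd, 'g) opd_map" +
  assumes col_in: "c \<in> Col P \<Longrightarrow> col_map F c \<in> Col Q"
    and op_in: "f \<in> Ops P \<Longrightarrow> op_map F f \<in> Ops Q"
    and map_Ins: "f \<in> Ops P \<Longrightarrow> Ins Q (op_map F f) = map (col_map F) (Ins P f)"
    and map_Out: "f \<in> Ops P \<Longrightarrow> Out Q (op_map F f) = col_map F (Out P f)"
    and map_Unit: "c \<in> Col P \<Longrightarrow> op_map F (Unit P c) = Unit Q (col_map F c)"
    and map_Opcomp: "pluggable P f gs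
      \<Longrightarrow> op_map F (Opcomp P f gs) = Opcomp Q (op_map F f) (map (op_map F) gs)"

definition constants :: "('c, 'f) opd \<Rightarrow> 'c \<Rightarrow> 'f set" where
  "constants P c = {f \<in> Ops P. Ins P f = [] \<and> Out P f = c}"


section \<open>Species and their free operads\<close>

record ('c, 'v) species =
  Colors :: "'c set"
  Nodes :: "'v set"
  Inputs :: "'v \<Rightarrow> 'c list"
  Output :: "'v \<Rightarrow> 'c"

locale wf_species =
  fixes S :: "('c, 'v) species"
  assumes Inputs_in: "x \<in> Nodes S \<Longrightarrow> set (Inputs S x) \<subseteq> Colors S"
    and Output_in: "x \<in> Nodes S \<Longrightarrow> Output S x \<in> Colors S"

locale finite_species = wf_species S for S :: "('c, 'v) species" +
  assumes finite_Colors: "finite (Colors S)"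
    and finite_Nodes: "finite (Nodes S)"

text \<open>Operations of the free operad are the well-typed trees of nodes. The leaves of a tree, from
  left to right, are its inputs; \<open>Leaf R\<close> on its own is the identity of the color \<open>R\<close>, and a
  nullary node \<open>x\<close> gives the constant \<open>Node x []\<close>.\<close>

datatype ('c, 'v) tree = Leaf 'c | Node 'v "('c, 'v) tree list"

primrec leaves :: "('c, 'v) tree \<Rightarrow> 'c list" where
  "leaves (Leaf R) = [R]"
| "leaves (Node x ts) = concat (map leaves ts)"

primrec root_color :: "('c, 'v) species \<Rightarrow> ('c, 'v) tree \<Rightarrow> 'c" where
  "root_color S (Leaf R) = R"
| "root_color S (Node x ts) = Output S x"

fun well_typed :: "('c, 'v) species \<Rightarrow> ('c, 'v) tree \<Rightarrow> bool" where
  "well_typed S (Leaf R) \<longleftrightarrow> R \<in> Colors S"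
| "well_typed S (Node x ts) \<longleftrightarrow>
     x \<in> Nodes S \<and> map (root_color S) ts = Inputs S x \<and> (\<forall>t\<in>set ts. well_typed S t)"

text \<open>\<open>graft t gs\<close> replaces the leaves of \<open>t\<close>, from left to right, by the trees \<open>gs\<close>.\<close>

fun graft :: "('c, 'v) tree \<Rightarrow> ('c, 'v) tree list \<Rightarrow> ('c, 'v) tree"
  and grafts :: "('c, 'v) tree list \<Rightarrow> ('c, 'v) tree list \<Rightarrow> ('c, 'v) tree list" where
  "graft (Leaf R) gs = hd gs"
| "graft (Node x ts) gs = Node x (grafts ts gs)"
| "grafts [] gs = []"
| "grafts (t # ts) gs =
     graft t (take (length (leaves t)) gs) # grafts ts (drop (length (leaves t)) gs)"

definition free_operad :: "('c, 'v) species \<Rightarrow> ('c, ('c, 'v) tree) opd" where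
  "free_operad S = \<lparr>Col = Colors S, Ops = {t. well_typed S t}, Ins = leaves, Out = root_color S,
     Unit = Leaf, Opcomp = graft\<rparr>"

text \<open>The functor from the free operad to \<open>P\<close> determined by its values on colors and nodes.\<close>

primrec extend_op :: "('d, 'g) opd \<Rightarrow> ('c \<Rightarrow> 'd) \<Rightarrow> ('v \<Rightarrow> 'g) \<Rightarrow> ('c, 'v) tree \<Rightarrow> 'g" where
  "extend_op P \<phi> \<psi> (Leaf R) = Unit P (\<phi> R)"
| "extend_op P \<phi> \<psi> (Node x ts) = Opcomp P (\<psi> x) (map (extend_op P \<phi> \<psi>) ts)"

definition free_extension ::
  "('d, 'g) opd \<Rightarrow> ('c \<Rightarrow> 'd) \<Rightarrow> ('v \<Rightarrow> 'g) \<Rightarrow> ('c, ('c, 'v) tree, 'd, 'g) opd_map" where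
  "free_extension P \<phi> \<psi> = \<lparr>col_map = \<phi>, op_map = extend_op P \<phi> \<psi>\<rparr>"


section \<open>Spliced arrows\<close>

text \<open>The operation \<open>w\<^sub>0 - \<dots> - w\<^sub>n\<close> is the nonempty list \<open>[w\<^sub>0, \<dots>, w\<^sub>n]\<close>. Its type is determined by
  the arrows: the \<open>i\<close>-th gap has color \<open>(A\<^sub>i, B\<^sub>i) = (Cod w\<^sub>i\<^sub>-\<^sub>1, Dom w\<^sub>i)\<close>.\<close>

definition gaps :: "('o, 'a) cat \<Rightarrow> 'a list \<Rightarrow> ('o \<times> 'o) list" where
  "gaps C ws = zip (map (Cod C) (butlast ws)) (map (Dom C) (tl ws))"

text \<open>\<open>(u\<^sub>0 - \<dots> - u\<^sub>m)(v\<^sub>0 - \<dots> - v\<^sub>n) = u\<^sub>0 - \<dots> - u\<^sub>m v\<^sub>0 - \<dots> - v\<^sub>n\<close>.\<close>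

definition glue :: "('o, 'a) cat \<Rightarrow> 'a list \<Rightarrow> 'a list \<Rightarrow> 'a list" where
  "glue C us vs = butlast us @ [Comp C (last us) (hd vs)] @ tl vs"

fun splice :: "('o, 'a) cat \<Rightarrow> 'a list \<Rightarrow> 'a list list \<Rightarrow> 'a list" where
  "splice C ws [] = ws"
| "splice C [] (u # us) = []"
| "splice C (w # ws) (u # us) = glue C (glue C [w] u) (splice C ws us)"

definition spliced_arrows :: "('o, 'a) cat \<Rightarrow> ('o \<times> 'o, 'a list) opd" where
  "spliced_arrows C = \<lparr>Col = Obj C \<times> Obj C, Ops = {ws. ws \<noteq> [] \<and> set ws \<subseteq> Arr C}, Ins = gaps C,
     Out = (\<lambda>ws. (Dom C (hd ws), Cod C (last ws))), Unit = (\<lambda>(A, B). [Id C A, Id C B]),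
     Opcomp = splice C\<rparr>"


section \<open>Context-free languages of arrows\<close>

definition context_free_grammar ::
  "('o, 'a) cat \<Rightarrow> ('c, 'v) species \<Rightarrow> 'c \<Rightarrow> ('c, ('c, 'v) tree, 'o \<times> 'o, 'a list) opd_map \<Rightarrow> bool"
  where
  "context_free_grammar C S s p \<longleftrightarrow> category C \<and> finitely_generated C \<and> finite_species S \<and>
     s \<in> Colors S \<and> operad_functor (free_operad S) (spliced_arrows C) p"

text \<open>A constant of the operad of spliced arrows is a one-element list \<open>[w]\<close>, identified with the
  arrow \<open>w\<close>.\<close>

definition grammar_language ::
  "('o, 'a) cat \<Rightarrow> ('c, 'v) species \<Rightarrow> 'c \<Rightarrow> ('c, ('c, 'v) tree, 'o \<times> 'o, 'a list) opd_map \<Rightarrow> 'a set"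
  where
  "grammar_language C S s p = {w \<in> Arr C. \<exists>t \<in> constants (free_operad S) s. op_map p t = [w]}"


section \<open>Contour categories and tree contour languages\<close>

record ('o, 'e) graph =
  Verts :: "'o set"
  Edges :: "'e set"
  Src :: "'e \<Rightarrow> 'o"
  Tgt :: "'e \<Rightarrow> 'o"

datatype ('o, 'e) path = Path (path_src: 'o) (path_edges: "'e list") (path_tgt: 'o)

fun is_walk :: "('o, 'e) graph \<Rightarrow> 'o \<Rightarrow> 'e list \<Rightarrow> 'o \<Rightarrow> bool" where
  "is_walk G a [] b \<longleftrightarrow> a \<in> Verts G \<and> a = b"
| "is_walk G a (e # es) b \<longleftrightarrow> e \<in> Edges G \<and> Src G e = a \<and> is_walk G (Tgt G e) es b"

definition free_category :: "('o, 'e) graph \<Rightarrow> ('o, ('o, 'e) path) cat" where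
  "free_category G = \<lparr>Obj = Verts G, Arr = {Path a es b | a es b. is_walk G a es b},
     Dom = path_src, Cod = path_tgt, Id = (\<lambda>a. Path a [] a),
     Comp = (\<lambda>f g. Path (path_src f) (path_edges f @ path_edges g) (path_tgt g))\<rparr>"

text \<open>\<open>Up R\<close> and \<open>Down R\<close> stand for \<open>R\<^sup>u\<close> and \<open>R\<^sup>d\<close>.\<close>

datatype 'c contour_obj = Up 'c | Down 'c

definition contour_graph :: "('c, 'v) species \<Rightarrow> ('c contour_obj, 'v \<times> nat) graph" where
  "contour_graph S =
     \<lparr>Verts = Up ` Colors S \<union> Down ` Colors S,
      Edges = {(x, i). x \<in> Nodes S \<and> i \<le> length (Inputs S x)},
      Src = (\<lambda>(x, i). if i = 0 then Up (Output S x) else Down (Inputs S x ! (i - 1))),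
      Tgt = (\<lambda>(x, i). if i = length (Inputs S x) then Down (Output S x) else Up (Inputs S x ! i))\<rparr>"

type_synonym ('c, 'v) contour_arrow = "('c contour_obj, 'v \<times> nat) path"

definition contour_category :: "('c, 'v) species \<Rightarrow> ('c contour_obj, ('c, 'v) contour_arrow) cat" where
  "contour_category S = free_category (contour_graph S)"

definition contour_gen :: "('c, 'v) species \<Rightarrow> 'v \<Rightarrow> nat \<Rightarrow> ('c, 'v) contour_arrow" where
  "contour_gen S x i = Path (Src (contour_graph S) (x, i)) [(x, i)] (Tgt (contour_graph S) (x, i))"

definition contour_functor ::
  "('c, 'v) species \<Rightarrow>
     ('c, ('c, 'v) tree, 'c contour_obj \<times> 'c contour_obj, ('c, 'v) contour_arrow list) opd_map" where
  "contour_functor S = free_extension (spliced_arrows (contour_category S))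
     (\<lambda>R. (Up R, Down R)) (\<lambda>x. map (contour_gen S x) [0..<Suc (length (Inputs S x))])"

definition tree_contour_language :: "('c, 'v) species \<Rightarrow> 'c \<Rightarrow> ('c, 'v) contour_arrow set" where
  "tree_contour_language S s = grammar_language (contour_category S) S s (contour_functor S)"


section \<open>Automata and regular languages of arrows\<close>

definition ulf :: "('o, 'a) cat \<Rightarrow> ('p, 'b) cat \<Rightarrow> ('o, 'a, 'p, 'b) cat_map \<Rightarrow> bool" where
  "ulf Q D p \<longleftrightarrow>
     (\<forall>\<alpha> \<in> Arr Q. \<forall>u \<in> Arr D. \<forall>v \<in> Arr D.
        Cod D u = Dom D v \<and> arr_map p \<alpha> = Comp D u v \<longrightarrow>
        (\<exists>!(\<beta>, \<gamma>). \<beta> \<in> Arr Q \<and> \<gamma> \<in> Arr Q \<and> Cod Q \<beta> = Dom Q \<gamma> \<and> \<alpha> = Comp Q \<beta> \<gamma> \<and>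
                 arr_map p \<beta> = u \<and> arr_map p \<gamma> = v))"

definition finitary :: "('o, 'a) cat \<Rightarrow> ('p, 'b) cat \<Rightarrow> ('o, 'a, 'p, 'b) cat_map \<Rightarrow> bool" where
  "finitary Q D p \<longleftrightarrow>
     (\<forall>A \<in> Obj D. finite {q \<in> Obj Q. obj_map p q = A}) \<and>
     (\<forall>w \<in> Arr D. finite {\<alpha> \<in> Arr Q. arr_map p \<alpha> = w})"

definition finite_state_automaton ::
  "('p, 'b) cat \<Rightarrow> ('o, 'a) cat \<Rightarrow> ('o, 'a, 'p, 'b) cat_map \<Rightarrow> 'o \<Rightarrow> 'o \<Rightarrow> bool" where
  "finite_state_automaton D Q p q0 qf \<longleftrightarrow>
     cat_functor Q D p \<and> ulf Q D p \<and> finitary Q D p \<and> q0 \<in> Obj Q \<and> qf \<in> Obj Q"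

definition automaton_language ::
  "('o, 'a) cat \<Rightarrow> ('o, 'a, 'p, 'b) cat_map \<Rightarrow> 'o \<Rightarrow> 'o \<Rightarrow> 'b set" where
  "automaton_language Q p q0 qf = arr_map p ` hom Q q0 qf"


section \<open>The constructions above are categories, operads and functors\<close>

subsection \<open>Contour categories\<close>

lemma is_walk_append:
  "is_walk G a es b \<Longrightarrow> is_walk G b fs c \<Longrightarrow> is_walk G a (es @ fs) c"
  by (induction es arbitrary: a) auto

lemma is_walk_verts:
  assumes "\<And>e. e \<in> Edges G \<Longrightarrow> Src G e \<in> Verts G" "is_walk G a es b"
  shows "a \<in> Verts G \<and> b \<in> Verts G"
  using assms(2) by (induction es arbitrary: a) (auto simp: assms(1))

lemma category_free_category:
  assumes "\<And>e. e \<in> Edges G \<Longrightarrow> Src G e \<in> Verts G"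
  shows "category (free_category G)"
  using is_walk_verts[OF assms]
  by unfold_locales (auto simp: free_category_def intro: is_walk_append)

context wf_species
begin

lemma nth_Inputs_in: "x \<in> Nodes S \<Longrightarrow> i < length (Inputs S x) \<Longrightarrow> Inputs S x ! i \<in> Colors S"
  using Inputs_in nth_mem by blast

lemma contour_Src_in: "e \<in> Edges (contour_graph S) \<Longrightarrow> Src (contour_graph S) e \<in> Verts (contour_graph S)"
  by (cases e) (auto simp: contour_graph_def Output_in nth_Inputs_in)

lemma contour_Tgt_in: "e \<in> Edges (contour_graph S) \<Longrightarrow> Tgt (contour_graph S) e \<in> Verts (contour_graph S)"
  by (cases e) (auto simp: contour_graph_def Output_in nth_Inputs_in)

lemma category_contour_category: "category (contour_category S)"
  unfolding contour_category_def using category_free_category contour_Src_in by blast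

lemma contour_gen_in:
  assumes "x \<in> Nodes S" "i \<le> length (Inputs S x)"
  shows "contour_gen S x i \<in> Arr (contour_category S)"
proof -
  have e: "(x, i) \<in> Edges (contour_graph S)"
    using assms by (simp add: contour_graph_def)
  show ?thesis
    using e contour_Tgt_in[OF e] by (simp add: contour_gen_def contour_category_def free_category_def)
qed

end

lemma finitely_generated_contour_category:
  assumes "finite_species S"
  shows "finitely_generated (contour_category S)"
proof -
  interpret finite_species S by fact
  interpret category "contour_category S" by (rule category_contour_category)
  let ?C = "contour_category S"
  let ?X = "(\<lambda>e. Path (Src (contour_graph S) e) [e] (Tgt (contour_graph S) e)) ` Edges (contour_graph S)"
  have "Edges (contour_graph S) = Sigma (Nodes S) (\<lambda>x. {..length (Inputs S x)})"
    by (auto simp: contour_graph_def)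
  then have fin: "finite ?X"
    by (simp add: finite_Nodes)
  have sub: "?X \<subseteq> Arr ?C"
    using contour_Tgt_in by (auto simp: contour_category_def free_category_def)
  have "Path a es b \<in> generated_arrows ?C ?X" if "is_walk (contour_graph S) a es b" for a es b
    using that
  proof (induction es arbitrary: a)
    case Nil
    then have "a \<in> Obj ?C" "Id ?C a = Path a [] b"
      by (auto simp: contour_category_def free_category_def)
    then show ?case
      using generated_arrows.ident[of a ?C ?X] Nil by simp
  next
    case (Cons e es)
    let ?e = "Path (Src (contour_graph S) e) [e] (Tgt (contour_graph S) e)"
    have "?e \<in> generated_arrows ?C ?X"
      using Cons.prems by (intro generated_arrows.gen) auto
    moreover have "Path (Tgt (contour_graph S) e) es b \<in> generated_arrows ?C ?X"
      using Cons by simp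
    ultimately have "Comp ?C ?e (Path (Tgt (contour_graph S) e) es b) \<in> generated_arrows ?C ?X"
      by (rule generated_arrows.comp) (simp add: contour_category_def free_category_def)
    then show ?case
      using Cons.prems by (simp add: contour_category_def free_category_def)
  qed
  then have "Arr ?C \<subseteq> generated_arrows ?C ?X"
    by (auto simp: contour_category_def free_category_def)
  moreover have "f \<in> Arr ?C" if "f \<in> generated_arrows ?C ?X" for f
    using that sub by induction (auto intro: Id_in Comp_in)
  ultimately have "Arr ?C = generated_arrows ?C ?X"
    by blast
  moreover have "finite (Obj ?C)"
    by (simp add: contour_category_def free_category_def contour_graph_def finite_Colors)
  ultimately show ?thesis
    unfolding finitely_generated_def using fin sub by blast
qed


subsection \<open>Free operads\<close>

fun chunks :: "nat list \<Rightarrow> 'a list \<Rightarrow> 'a list list" where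
  "chunks [] xs = []"
| "chunks (n # ns) xs = take n xs # chunks ns (drop n xs)"

lemma length_chunks [simp]: "length (chunks ns xs) = length ns"
  by (induction ns arbitrary: xs) auto

lemma concat_chunks: "length xs = sum_list ns \<Longrightarrow> concat (chunks ns xs) = xs"
  by (induction ns arbitrary: xs) auto

lemma grafts_conv: "grafts ts gs = map2 graft ts (chunks (map (length \<circ> leaves) ts) gs)"
  by (induction ts arbitrary: gs) auto

lemma length_leaves_Node: "length (leaves (Node x ts)) = sum_list (map (length \<circ> leaves) ts)"
  by (induction ts) auto

lemma concat_map_concat_leaves:
  "concat (map (concat \<circ> map leaves) gss) = concat (map leaves (concat gss))"
  by (induction gss) auto

context wf_species
begin

lemma root_in: "well_typed S t \<Longrightarrow> root_color S t \<in> Colors S"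
  by (cases t) (auto simp: Output_in)

lemma leaves_in: "well_typed S t \<Longrightarrow> set (leaves t) \<subseteq> Colors S"
  by (induction t) auto

lemma chunks_pluggable:
  assumes "map (root_color S) gs = concat (map leaves ts)" "\<forall>g\<in>set gs. well_typed S g"
  shows "list_all2 (\<lambda>t hs. map (root_color S) hs = leaves t \<and> (\<forall>h\<in>set hs. well_typed S h)) ts
    (chunks (map (length \<circ> leaves) ts) gs)"
  using assms
proof (induction ts arbitrary: gs)
  case (Cons t ts)
  have "map (root_color S) (take (length (leaves t)) gs) = leaves t"
    "map (root_color S) (drop (length (leaves t)) gs) = concat (map leaves ts)"
    using Cons.prems(1) by (simp_all add: take_map[symmetric] drop_map[symmetric])
  then show ?case
    using Cons.IH[of "drop (length (leaves t)) gs"] Cons.prems(2)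
    by (auto dest: in_set_takeD in_set_dropD)
qed simp

lemma graft_typed:
  assumes "well_typed S t" "map (root_color S) gs = leaves t" "\<forall>g\<in>set gs. well_typed S g"
  shows "well_typed S (graft t gs) \<and> root_color S (graft t gs) = root_color S t
    \<and> leaves (graft t gs) = concat (map leaves gs)"
  using assms
proof (induction t arbitrary: gs)
  case (Leaf R)
  then show ?case by auto
next
  case (Node x ts)
  let ?ch = "chunks (map (length \<circ> leaves) ts) gs"
  have 1: "list_all2 (\<lambda>t hs. map (root_color S) hs = leaves t \<and> (\<forall>h\<in>set hs. well_typed S h)) ts ?ch"
    using Node.prems by (intro chunks_pluggable) auto
  have "list_all2 (\<lambda>t hs. well_typed S (graft t hs) \<and> root_color S (graft t hs) = root_color S t
    \<and> leaves (graft t hs) = concat (map leaves hs)) ts ?ch"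
    using 1
  proof (rule list.rel_mono_strong)
    fix t hs
    assume "t \<in> set ts" "map (root_color S) hs = leaves t \<and> (\<forall>h\<in>set hs. well_typed S h)"
    then show "well_typed S (graft t hs) \<and> root_color S (graft t hs) = root_color S t
      \<and> leaves (graft t hs) = concat (map leaves hs)"
      using Node.IH[of t hs] Node.prems by auto
  qed
  then have 2: "(\<forall>s\<in>set (map2 graft ts ?ch). well_typed S s)
      \<and> map (root_color S) (map2 graft ts ?ch) = map (root_color S) ts
      \<and> map leaves (map2 graft ts ?ch) = map (concat \<circ> map leaves) ?ch"
    by (induction rule: list_all2_induct) auto
  have "length gs = sum_list (map (length \<circ> leaves) ts)"
    using Node.prems(2) by (metis length_map length_leaves_Node)
  then have "concat ?ch = gs"
    by (rule concat_chunks)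
  then have "concat (map (concat \<circ> map leaves) ?ch) = concat (map leaves gs)"
    by (metis concat_map_concat_leaves)
  with 2 show ?case
    using Node.prems by (auto simp: grafts_conv)
qed

lemma graft_Leaves: "graft t (map Leaf (leaves t)) = t"
proof (induction t)
  case (Node x ts)
  have "grafts ts (map Leaf (concat (map leaves ts))) = ts"
    using Node by (induction ts) auto
  then show ?case by simp
qed simp

lemma graft_graft:
  assumes "length gs = length (leaves t)" "list_all2 (\<lambda>g hs. length hs = length (leaves g)) gs hss"
    and "well_typed S t" "map (root_color S) gs = leaves t" "\<forall>g\<in>set gs. well_typed S g"
  shows "graft (graft t gs) (concat hss) = graft t (map2 graft gs hss)"
  using assms
proof (induction t arbitrary: gs hss)
  case (Leaf R)
  then obtain g where "gs = [g]" by (cases gs) auto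
  with Leaf obtain hs where "hss = [hs]" by (auto simp: list_all2_Cons1)
  with \<open>gs = [g]\<close> show ?case by simp
next
  case (Node x ts)
  have aux: "grafts (grafts ts gs) (concat hss) = grafts ts (map2 graft gs hss)"
    if "\<And>t gs hss. t \<in> set ts \<Longrightarrow> length gs = length (leaves t) \<Longrightarrow>
        list_all2 (\<lambda>g hs. length hs = length (leaves g)) gs hss \<Longrightarrow> well_typed S t \<Longrightarrow>
        map (root_color S) gs = leaves t \<Longrightarrow> \<forall>g\<in>set gs. well_typed S g \<Longrightarrow>
        graft (graft t gs) (concat hss) = graft t (map2 graft gs hss)"
      and "list_all2 (\<lambda>g hs. length hs = length (leaves g)) gs hss"
      and "\<forall>t\<in>set ts. well_typed S t" "map (root_color S) gs = concat (map leaves ts)"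
      and "\<forall>g\<in>set gs. well_typed S g"
    using that
  proof (induction ts arbitrary: gs hss)
    case (Cons t ts)
    let ?n = "length (leaves t)"
    have split: "map (root_color S) (take ?n gs) = leaves t"
      "map (root_color S) (drop ?n gs) = concat (map leaves ts)"
      using Cons.prems(4) by (simp_all add: take_map[symmetric] drop_map[symmetric])
    have ty: "\<forall>g\<in>set (take ?n gs). well_typed S g" "\<forall>g\<in>set (drop ?n gs). well_typed S g"
      using Cons.prems(5) by (auto dest: in_set_takeD in_set_dropD)
    have lens: "list_all2 (\<lambda>g hs. length hs = length (leaves g)) (take ?n gs) (take ?n hss)"
      "list_all2 (\<lambda>g hs. length hs = length (leaves g)) (drop ?n gs) (drop ?n hss)"
      using Cons.prems(2) by (simp_all add: list_all2_takeI list_all2_dropI)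
    have len: "length (take ?n gs) = ?n"
      using split(1) by (metis length_map)
    have t1: "graft (graft t (take ?n gs)) (concat (take ?n hss)) = graft t (map2 graft (take ?n gs) (take ?n hss))"
      using Cons.prems(1)[of t] Cons.prems(3) len lens(1) split(1) ty(1) by simp
    have t2: "grafts (grafts ts (drop ?n gs)) (concat (drop ?n hss)) = grafts ts (map2 graft (drop ?n gs) (drop ?n hss))"
      by (rule Cons.IH) (use Cons.prems lens(2) split(2) ty(2) in auto)
    have "leaves (graft t (take ?n gs)) = concat (map leaves (take ?n gs))"
      using graft_typed[of t "take ?n gs"] Cons.prems(3) split(1) ty(1) by simp
    moreover have "length (concat (take ?n hss)) = length (concat (map leaves (take ?n gs)))"
      using lens(1) by (induction rule: list_all2_induct) auto
    ultimately have l: "length (leaves (graft t (take ?n gs))) = length (concat (take ?n hss))"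
      by simp
    have c: "concat hss = concat (take ?n hss) @ concat (drop ?n hss)"
      by (metis append_take_drop_id concat_append)
    show ?case
      using t1 t2 l by (subst c) (simp add: take_map drop_map take_zip drop_zip)
  qed simp
  have "grafts (grafts ts gs) (concat hss) = grafts ts (map2 graft gs hss)"
  proof (rule aux)
    show "list_all2 (\<lambda>g hs. length hs = length (leaves g)) gs hss" "\<forall>g\<in>set gs. well_typed S g"
      by fact+
    show "\<forall>t\<in>set ts. well_typed S t" "map (root_color S) gs = concat (map leaves ts)"
      using Node.prems(3,4) by simp_all
  qed (rule Node.IH)
  then show ?case by simp
qed

lemma operad_free_operad: "operad (free_operad S)"
proof
  fix f gs hss
  assume 1: "pluggable (free_operad S) f gs" and 2: "list_all2 (pluggable (free_operad S)) gs hss"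
  have "list_all2 (\<lambda>g hs. length hs = length (leaves g)) gs hss"
    using 2 by (rule list_all2_mono) (auto simp: pluggable_def free_operad_def dest: map_eq_imp_length_eq,
        metis length_map)
  moreover have "length gs = length (leaves f)"
    using 1 by (simp add: pluggable_def free_operad_def) (metis length_map)
  ultimately show "Opcomp (free_operad S) (Opcomp (free_operad S) f gs) (concat hss) =
      Opcomp (free_operad S) f (map2 (Opcomp (free_operad S)) gs hss)"
    using graft_graft 1 by (auto simp: pluggable_def free_operad_def)
next
  fix f gs assume "pluggable (free_operad S) f gs"
  then have "well_typed S f" "map (root_color S) gs = leaves f" "\<forall>g\<in>set gs. well_typed S g"
    by (auto simp: pluggable_def free_operad_def)
  from graft_typed[OF this]
  show "Opcomp (free_operad S) f gs \<in> Ops (free_operad S)"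
    "Ins (free_operad S) (Opcomp (free_operad S) f gs) = concat (map (Ins (free_operad S)) gs)"
    "Out (free_operad S) (Opcomp (free_operad S) f gs) = Out (free_operad S) f"
    by (simp_all add: free_operad_def)
qed (use leaves_in root_in graft_Leaves in \<open>auto simp: free_operad_def\<close>)

lemma operad_functor_free_extension:
  assumes "operad P"
    and "\<And>R. R \<in> Colors S \<Longrightarrow> \<phi> R \<in> Col P"
    and "\<And>x. x \<in> Nodes S \<Longrightarrow> \<psi> x \<in> Ops P \<and> Ins P (\<psi> x) = map \<phi> (Inputs S x) \<and> Out P (\<psi> x) = \<phi> (Output S x)"
  shows "operad_functor (free_operad S) P (free_extension P \<phi> \<psi>)"
proof -
  interpret P: operad P by fact
  interpret F: operad "free_operad S" by (rule operad_free_operad)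
  let ?e = "extend_op P \<phi> \<psi>"
  have ty: "?e t \<in> Ops P \<and> Ins P (?e t) = map \<phi> (leaves t) \<and> Out P (?e t) = \<phi> (root_color S t)"
    if "well_typed S t" for t
    using that
  proof (induction t)
    case (Leaf R)
    then show ?case
      by (simp add: assms(2) P.Unit_in P.Ins_Unit P.Out_Unit)
  next
    case (Node x ts)
    have "map (\<lambda>t. Out P (?e t)) ts = map (\<lambda>t. \<phi> (root_color S t)) ts"
      using Node by auto
    also have "\<dots> = map \<phi> (Inputs S x)"
      using Node.prems by (simp flip: map_map[unfolded comp_def])
    finally have pl: "pluggable P (\<psi> x) (map ?e ts)"
      using Node assms(3) by (auto simp: pluggable_def comp_def)
    have "map (\<lambda>t. Ins P (?e t)) ts = map (\<lambda>t. map \<phi> (leaves t)) ts"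
      using Node by auto
    then have "concat (map (\<lambda>t. Ins P (?e t)) ts) = map \<phi> (concat (map leaves ts))"
      by (simp only: map_concat map_map comp_def)
    then show ?case
      using P.Opcomp_in[OF pl] P.Ins_Opcomp[OF pl] P.Out_Opcomp[OF pl] assms(3) Node.prems
      by (simp add: comp_def)
  qed
  have comp: "?e (graft t gs) = Opcomp P (?e t) (map ?e gs)"
    if "well_typed S t" "map (root_color S) gs = leaves t" "\<forall>g\<in>set gs. well_typed S g" for t gs
    using that
  proof (induction t arbitrary: gs)
    case (Leaf R)
    then obtain g where g: "gs = [g]" "root_color S g = R" "well_typed S g" by auto
    then show ?case
      using ty[of g] P.Unit_Opcomp[of "?e g"] by simp
  next
    case (Node x ts)
    let ?ch = "chunks (map (length \<circ> leaves) ts) gs"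
    have 1: "list_all2 (\<lambda>t hs. map (root_color S) hs = leaves t \<and> (\<forall>h\<in>set hs. well_typed S h)) ts ?ch"
      using Node.prems by (intro chunks_pluggable) auto
    have "list_all2 (\<lambda>t hs. ?e (graft t hs) = Opcomp P (?e t) (map ?e hs) \<and>
        pluggable P (?e t) (map ?e hs)) ts ?ch"
      using 1
    proof (rule list.rel_mono_strong)
      fix t hs
      assume a: "t \<in> set ts" "map (root_color S) hs = leaves t \<and> (\<forall>h\<in>set hs. well_typed S h)"
      then have t: "well_typed S t"
        using Node.prems by auto
      have "map (\<lambda>h. Out P (?e h)) hs = map (\<lambda>h. \<phi> (root_color S h)) hs"
        using a ty by auto
      also have "\<dots> = map \<phi> (leaves t)"
        using a by (simp flip: map_map[unfolded comp_def])
      finally show "?e (graft t hs) = Opcomp P (?e t) (map ?e hs) \<and> pluggable P (?e t) (map ?e hs)"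
        using Node.IH[of t hs] a t ty by (auto simp: pluggable_def comp_def)
    qed
    then have 2: "map ?e (map2 graft ts ?ch) = map2 (Opcomp P) (map ?e ts) (map (map ?e) ?ch)"
      and 3: "list_all2 (pluggable P) (map ?e ts) (map (map ?e) ?ch)"
      by (induction rule: list_all2_induct) auto
    have "map (\<lambda>t. Out P (?e t)) ts = map (\<lambda>t. \<phi> (root_color S t)) ts"
      using Node.prems ty by auto
    also have "\<dots> = map \<phi> (Inputs S x)"
      using Node.prems by (simp flip: map_map[unfolded comp_def])
    finally have pl: "pluggable P (\<psi> x) (map ?e ts)"
      using Node.prems assms(3) ty by (auto simp: pluggable_def comp_def)
    have "length gs = sum_list (map (length \<circ> leaves) ts)"
      using Node.prems(2) by (metis length_map length_leaves_Node)
    then have "concat ?ch = gs"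
      by (rule concat_chunks)
    then have "concat (map (map ?e) ?ch) = map ?e gs"
      by (metis map_concat)
    then show ?case
      using P.Opcomp_assoc[OF pl 3] 2 by (simp add: grafts_conv)
  qed
  show ?thesis
  proof
    fix t gs assume "pluggable (free_operad S) t gs"
    then have "well_typed S t" "map (root_color S) gs = leaves t" "\<forall>g\<in>set gs. well_typed S g"
      by (auto simp: pluggable_def free_operad_def)
    from comp[OF this]
    show "op_map (free_extension P \<phi> \<psi>) (Opcomp (free_operad S) t gs) =
        Opcomp P (op_map (free_extension P \<phi> \<psi>) t) (map (op_map (free_extension P \<phi> \<psi>)) gs)"
      by (simp add: free_extension_def free_operad_def)
  qed (use ty assms(2) in \<open>auto simp: free_extension_def free_operad_def\<close>)
qed

end


subsection \<open>Spliced arrows\<close>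

lemma gaps_simps [simp]:
  "gaps C [] = []" "gaps C [w] = []" "gaps C (w # v # ws) = (Cod C w, Dom C v) # gaps C (v # ws)"
  by (simp_all add: gaps_def)

lemma glue_simps [simp]:
  "v \<noteq> [] \<Longrightarrow> glue C [w] v = Comp C w (hd v) # tl v"
  "u \<noteq> [] \<Longrightarrow> glue C (w # u) v = w # glue C u v"
  by (auto simp: glue_def)

lemma glue_not_Nil [simp]: "glue C u v \<noteq> []"
  by (simp add: glue_def)

context category
begin

definition spliced :: "'a list \<Rightarrow> bool" where
  "spliced ws \<longleftrightarrow> ws \<noteq> [] \<and> set ws \<subseteq> Arr C"

lemma glue_typed:
  assumes "spliced u" "spliced v" "Cod C (last u) = Dom C (hd v)"
  shows "spliced (glue C u v)" "Dom C (hd (glue C u v)) = Dom C (hd u)"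
    "Cod C (last (glue C u v)) = Cod C (last v)" "gaps C (glue C u v) = gaps C u @ gaps C v"
proof -
  have "spliced (glue C u v) \<and> Dom C (hd (glue C u v)) = Dom C (hd u) \<and>
    Cod C (last (glue C u v)) = Cod C (last v) \<and> gaps C (glue C u v) = gaps C u @ gaps C v"
    using assms
  proof (induction u)
    case (Cons w u)
    show ?case
    proof (cases u)
      case Nil
      obtain x vs where v: "v = x # vs"
        using Cons.prems by (cases v) (auto simp: spliced_def)
      show ?thesis
        using Cons.prems Nil v by (cases vs) (auto simp: spliced_def Comp_in Dom_Comp Cod_Comp)
    next
      case (Cons y ys)
      have "spliced u"
        using Cons.prems Cons by (auto simp: spliced_def)
      then show ?thesis
        using Cons.IH Cons.prems Cons
        by (cases "glue C u v") (auto simp: spliced_def)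
    qed
  qed (simp add: spliced_def)
  then show "spliced (glue C u v)" "Dom C (hd (glue C u v)) = Dom C (hd u)"
    "Cod C (last (glue C u v)) = Cod C (last v)" "gaps C (glue C u v) = gaps C u @ gaps C v"
    by auto
qed

lemma glue_assoc:
  assumes "spliced u" "spliced v" "spliced w"
    and "Cod C (last u) = Dom C (hd v)" "Cod C (last v) = Dom C (hd w)"
  shows "glue C (glue C u v) w = glue C u (glue C v w)"
  using assms
proof (induction u)
  case (Cons a u)
  show ?case
  proof (cases u)
    case Nil
    obtain b vs where v: "v = b # vs"
      using Cons.prems by (cases v) (auto simp: spliced_def)
    have "hd w \<in> Arr C"
      using Cons.prems by (cases w) (auto simp: spliced_def)
    then show ?thesis
      using Cons.prems Nil v by (cases "vs = []") (auto simp: spliced_def Comp_assoc)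
  qed (use Cons in \<open>auto simp: spliced_def\<close>)
qed (simp add: spliced_def)

abbreviation "fits ws us \<equiv> pluggable (spliced_arrows C) ws us"

lemma fits_iff:
  "fits ws us \<longleftrightarrow> spliced ws \<and> (\<forall>u\<in>set us. spliced u)
    \<and> map (\<lambda>u. (Dom C (hd u), Cod C (last u))) us = gaps C ws"
  by (auto simp: pluggable_def spliced_arrows_def spliced_def)

lemma fits_single: "fits [w] us \<longleftrightarrow> w \<in> Arr C \<and> us = []"
  by (auto simp: fits_iff spliced_def)

lemma fits_Cons:
  "fits (w # v # ws) us \<longleftrightarrow> (\<exists>u us'. us = u # us' \<and> w \<in> Arr C \<and> spliced u \<and>
     Dom C (hd u) = Cod C w \<and> Cod C (last u) = Dom C v \<and> fits (v # ws) us')"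
  by (cases us) (auto simp: fits_iff spliced_def)

lemma splice_typed:
  assumes "fits ws us"
  shows "spliced (splice C ws us) \<and> Dom C (hd (splice C ws us)) = Dom C (hd ws) \<and>
    Cod C (last (splice C ws us)) = Cod C (last ws) \<and>
    gaps C (splice C ws us) = concat (map (gaps C) us)"
  using assms
proof (induction ws arbitrary: us)
  case Nil
  then show ?case by (simp add: fits_iff spliced_def)
next
  case (Cons w ws)
  show ?case
  proof (cases ws)
    case Nil
    then show ?thesis
      using Cons.prems by (auto simp: fits_single spliced_def)
  next
    case (Cons v vs)
    then obtain u us' where u: "us = u # us'" "w \<in> Arr C" "spliced u" "Dom C (hd u) = Cod C w"
      "Cod C (last u) = Dom C v" "fits ws us'"
      using Cons.prems by (auto simp: fits_Cons)
    note IH = Cons.IH[OF u(6)]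
    have w: "spliced [w]"
      using u by (simp add: spliced_def)
    note g1 = glue_typed[OF w u(3)]
    note g2 = glue_typed[of "glue C [w] u" "splice C ws us'"]
    show ?thesis
      using u IH g1 g2 Cons by (simp del: glue_simps)
  qed
qed

lemma splice_glue:
  assumes "fits a xs" "fits b ys" "Cod C (last a) = Dom C (hd b)"
  shows "splice C (glue C a b) (xs @ ys) = glue C (splice C a xs) (splice C b ys)"
  using assms
proof (induction a arbitrary: xs)
  case Nil
  then show ?case by (simp add: fits_iff spliced_def)
next
  case (Cons w a)
  show ?case
  proof (cases a)
    case Nil
    then have xs: "xs = []" "w \<in> Arr C"
      using Cons.prems by (auto simp: fits_single)
    show ?thesis
    proof (cases ys)
      case Nil
      then show ?thesis using xs \<open>a = []\<close> by simp
    next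
      case (Cons y ys')
      then obtain b0 b1 bs where b: "b = b0 # b1 # bs"
        using \<open>fits b ys\<close> by (cases b rule: remdups_adj.cases) (auto simp: fits_single fits_iff)
      then have y: "b0 \<in> Arr C" "spliced y" "Dom C (hd y) = Cod C b0" "Cod C (last y) = Dom C b1"
        "fits (b1 # bs) ys'"
        using \<open>fits b ys\<close> Cons by (auto simp: fits_Cons)
      have s: "spliced [w]" "spliced [b0]" "Cod C w = Dom C b0"
        using xs y Cons.prems b \<open>a = []\<close> by (auto simp: spliced_def)
      note t = splice_typed[OF y(5)]
      have "splice C (glue C (w # a) b) (xs @ ys) =
          glue C (glue C (glue C [w] [b0]) y) (splice C (b1 # bs) ys')"
        using b Cons xs \<open>a = []\<close> by (simp add: glue_def)
      also have "glue C (glue C [w] [b0]) y = glue C [w] (glue C [b0] y)"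
        using s y by (intro glue_assoc) auto
      also have "glue C (glue C [w] (glue C [b0] y)) (splice C (b1 # bs) ys') =
          glue C [w] (glue C (glue C [b0] y) (splice C (b1 # bs) ys'))"
        using s y t glue_typed[of "[b0]" y] by (intro glue_assoc) auto
      finally show ?thesis
        using b Cons xs \<open>a = []\<close> by simp
    qed
  next
    case (Cons v vs)
    then obtain u us' where u: "xs = u # us'" "w \<in> Arr C" "spliced u" "Dom C (hd u) = Cod C w"
      "Cod C (last u) = Dom C v" "fits a us'"
      using Cons.prems by (auto simp: fits_Cons)
    have w: "spliced [w]"
      using u by (simp add: spliced_def)
    note IH = Cons.IH[OF u(6) \<open>fits b ys\<close>]
    note t1 = splice_typed[OF u(6)] and t2 = splice_typed[OF \<open>fits b ys\<close>]
    note g = glue_typed[OF w u(3)]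
    have c: "Cod C (last a) = Dom C (hd b)"
      using Cons.prems(3) Cons by simp
    have "splice C (glue C (w # a) b) (xs @ ys) =
        glue C (glue C [w] u) (splice C (glue C a b) (us' @ ys))"
      using Cons u(1) by simp
    also have "\<dots> = glue C (glue C [w] u) (glue C (splice C a us') (splice C b ys))"
      using IH c by simp
    also have "\<dots> = glue C (glue C (glue C [w] u) (splice C a us')) (splice C b ys)"
      by (rule glue_assoc[symmetric]) (use g t1 t2 c u Cons in \<open>simp_all del: glue_simps\<close>)
    finally show ?thesis
      using u(1) by simp
  qed
qed

lemma splice_assoc:
  assumes "fits ws us" "list_all2 fits us xss"
  shows "splice C (splice C ws us) (concat xss) = splice C ws (map2 (splice C) us xss)"
  using assms
proof (induction ws arbitrary: us xss)
  case Nil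
  then show ?case by (simp add: fits_iff spliced_def)
next
  case (Cons w ws)
  show ?case
  proof (cases ws)
    case Nil
    then show ?thesis
      using Cons.prems by (auto simp: fits_single)
  next
    case (Cons v vs)
    then obtain u us' where u: "us = u # us'" "w \<in> Arr C" "spliced u" "Dom C (hd u) = Cod C w"
      "Cod C (last u) = Dom C v" "fits ws us'"
      using Cons.prems by (auto simp: fits_Cons)
    then obtain xs xss' where x: "xss = xs # xss'" "fits u xs" "list_all2 fits us' xss'"
      using Cons.prems by (auto simp: list_all2_Cons1)
    have w: "fits [w] []" "spliced [w]"
      using u by (auto simp: spliced_def fits_single)
    note g = glue_typed[OF w(2) u(3)]
    note t = splice_typed[OF u(6)]
    have fits1: "fits (glue C [w] u) xs"
      using g x(2) u(4) by (auto simp: fits_iff simp del: glue_simps)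
    have fits2: "fits (splice C ws us') (concat xss')"
    proof -
      have "map (\<lambda>u. (Dom C (hd u), Cod C (last u))) (concat xss') = concat (map (gaps C) us')
          \<and> (\<forall>x\<in>set (concat xss'). spliced x)"
        using x(3) by (induction rule: list_all2_induct) (auto simp: fits_iff)
      then show ?thesis
        using t by (simp add: fits_iff)
    qed
    have "splice C (splice C (w # ws) us) (concat xss) =
        glue C (splice C (glue C [w] u) xs) (splice C (splice C ws us') (concat xss'))"
      using splice_glue[OF fits1 fits2] g t u x(1) Cons by (simp del: glue_simps)
    also have "splice C (glue C [w] u) xs = glue C [w] (splice C u xs)"
      using splice_glue[OF w(1) x(2)] u(4) by simp
    also have "splice C (splice C ws us') (concat xss') = splice C ws (map2 (splice C) us' xss')"
      using Cons.IH[OF u(6) x(3)] .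
    finally show ?thesis
      using u(1) x(1) by simp
  qed
qed

lemma splice_units:
  "spliced ws \<Longrightarrow> splice C ws (map (\<lambda>(A, B). [Id C A, Id C B]) (gaps C ws)) = ws"
proof (induction ws)
  case (Cons w ws)
  show ?case
  proof (cases ws)
    case (Cons v vs)
    then have "splice C ws (map (\<lambda>(A, B). [Id C A, Id C B]) (gaps C ws)) = ws"
      using Cons.IH Cons.prems by (auto simp: spliced_def)
    then show ?thesis
      using Cons Cons.prems by (simp add: spliced_def Comp_Id Id_Comp)
  qed simp
qed (simp add: spliced_def)

lemma operad_spliced_arrows: "operad (spliced_arrows C)"
proof
  fix ws assume "ws \<in> Ops (spliced_arrows C)"
  then have s: "spliced ws"
    by (simp add: spliced_arrows_def spliced_def)
  have "set (gaps C ws) \<subseteq> Obj C \<times> Obj C"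
    using s
  proof (induction ws)
    case (Cons w ws)
    then show ?case by (cases ws) (auto simp: spliced_def Dom_in Cod_in)
  qed simp
  then show "set (Ins (spliced_arrows C) ws) \<subseteq> Col (spliced_arrows C)"
    by (simp add: spliced_arrows_def)
  show "Out (spliced_arrows C) ws \<in> Col (spliced_arrows C)"
    using s by (auto simp: spliced_arrows_def spliced_def intro!: Dom_in Cod_in)
  show "Opcomp (spliced_arrows C) (Unit (spliced_arrows C) (Out (spliced_arrows C) ws)) [ws] = ws"
  proof -
    have "Comp C (Id C (Dom C (hd ws))) (hd ws) # tl ws = ws"
      using s by (cases ws) (auto simp: spliced_def Id_Comp)
    moreover have "glue C ws [Id C (Cod C (last ws))] = ws"
      using s by (simp add: glue_def spliced_def Comp_Id subset_iff)
    ultimately show ?thesis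
      using s by (simp add: spliced_arrows_def spliced_def)
  qed
  show "Opcomp (spliced_arrows C) ws (map (Unit (spliced_arrows C)) (Ins (spliced_arrows C) ws)) = ws"
    using splice_units[OF s] by (simp add: spliced_arrows_def)
next
  fix ws us assume "fits ws us"
  from splice_typed[OF this]
  show "Opcomp (spliced_arrows C) ws us \<in> Ops (spliced_arrows C)"
    "Ins (spliced_arrows C) (Opcomp (spliced_arrows C) ws us) = concat (map (Ins (spliced_arrows C)) us)"
    "Out (spliced_arrows C) (Opcomp (spliced_arrows C) ws us) = Out (spliced_arrows C) ws"
    by (simp_all add: spliced_arrows_def spliced_def)
next
  fix ws us xss assume "fits ws us" "list_all2 fits us xss"
  from splice_assoc[OF this]
  show "Opcomp (spliced_arrows C) (Opcomp (spliced_arrows C) ws us) (concat xss) =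
      Opcomp (spliced_arrows C) ws (map2 (Opcomp (spliced_arrows C)) us xss)"
    by (simp add: spliced_arrows_def)
qed (auto simp: spliced_arrows_def Id_in Dom_Id Cod_Id)

end


subsection \<open>The tree contour grammar\<close>

lemma context_free_grammar_contour:
  assumes "finite_species S" "s \<in> Colors S"
  shows "context_free_grammar (contour_category S) S s (contour_functor S)"
proof -
  interpret finite_species S by fact
  interpret C: category "contour_category S" by (rule category_contour_category)
  have "operad_functor (free_operad S) (spliced_arrows (contour_category S)) (contour_functor S)"
    unfolding contour_functor_def
  proof (rule operad_functor_free_extension[OF C.operad_spliced_arrows])
    fix R assume "R \<in> Colors S"
    then show "(Up R, Down R) \<in> Col (spliced_arrows (contour_category S))"
      by (simp add: spliced_arrows_def contour_category_def free_category_def contour_graph_def)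
  next
    fix x assume x: "x \<in> Nodes S"
    let ?n = "length (Inputs S x)"
    let ?w = "map (contour_gen S x) [0..<Suc ?n]"
    let ?C = "contour_category S"
    have in_: "set ?w \<subseteq> Arr ?C"
      using contour_gen_in[OF x] by auto
    have "gaps ?C ?w = map (\<lambda>R. (Up R, Down R)) (Inputs S x)"
      by (rule nth_equalityI)
        (auto simp: gaps_def nth_butlast nth_tl contour_gen_def contour_category_def
          free_category_def contour_graph_def simp del: upt_Suc)
    moreover have "Dom ?C (hd ?w) = Up (Output S x)" "Cod ?C (last ?w) = Down (Output S x)"
      by (simp_all add: hd_map last_map contour_gen_def contour_category_def free_category_def
          contour_graph_def del: upt_Suc)
    ultimately show "?w \<in> Ops (spliced_arrows ?C) \<and>
        Ins (spliced_arrows ?C) ?w = map (\<lambda>R. (Up R, Down R)) (Inputs S x) \<and>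
        Out (spliced_arrows ?C) ?w = (Up (Output S x), Down (Output S x))"
      using in_ by (simp add: spliced_arrows_def)
  qed
  then show ?thesis
    unfolding context_free_grammar_def
    using assms category_contour_category finitely_generated_contour_category by blast
qed

lemma grammar_language_hom:
  assumes "context_free_grammar C S s p" "col_map p s = (A, B)"
  shows "grammar_language C S s p \<subseteq> hom C A B"
proof
  fix w assume "w \<in> grammar_language C S s p"
  then obtain t where t: "w \<in> Arr C" "t \<in> Ops (free_operad S)" "Out (free_operad S) t = s" "op_map p t = [w]"
    by (auto simp: grammar_language_def constants_def)
  have "operad_functor (free_operad S) (spliced_arrows C) p"
    using assms(1) by (simp add: context_free_grammar_def)
  from operad_functor.map_Out[OF this t(2)] show "w \<in> hom C A B"
    using t assms(2) by (simp add: spliced_arrows_def hom_def)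
qed

end

theory Submission
  imports Defs
begin

text \<open>Recolor the species \<open>S\<close> along \<open>p\<close>: the same nodes, now typed by pairs of objects of \<open>C\<close>. This
  induces a functor \<open>\<pi>\<close> from the contour category of \<open>S\<close> to that of the recolored species \<open>R\<close>. As
  \<open>\<pi>\<close> is the identity on generating edges, it is a finitary ULF functor, that is, an automaton.
  The arrows \<open>p(x)\<^sub>i\<close> define \<open>q\<close> on the generators \<open>(x, i)\<close>, and \<open>p\<close> factors through
  the contour functor of \<open>R\<close> followed by the image of splicing under \<open>q\<close>. Finally, the contour of a closed
  \<open>R\<close>-tree lifts along \<open>\<pi>\<close> to an arrow \<open>s\<^sup>u \<rightarrow> s\<^sup>d\<close> exactly if the tree is well typed in \<open>S\<close>
  with root \<open>s\<close>, since each edge \<open>(x, i)\<close> of the walk forces the \<open>S\<close>-color at its ends.\<close>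

section \<open>Operad functors\<close>

lemma (in operad_functor) pluggable_map:
  assumes "pluggable P f gs"
  shows "pluggable Q (op_map F f) (map (op_map F) gs)"
proof -
  have "map (\<lambda>g. Out Q (op_map F g)) gs = map (\<lambda>g. col_map F (Out P g)) gs"
    using assms by (auto simp: pluggable_def map_Out)
  also have "\<dots> = Ins Q (op_map F f)"
    using assms by (simp add: pluggable_def map_Ins flip: map_map[unfolded comp_def])
  finally show ?thesis
    using assms by (auto simp: pluggable_def op_in comp_def)
qed

definition opd_map_comp ::
  "('c, 'f, 'd, 'g) opd_map \<Rightarrow> ('d, 'g, 'e, 'h) opd_map \<Rightarrow> ('c, 'f, 'e, 'h) opd_map" where
  "opd_map_comp F G = \<lparr>col_map = col_map G \<circ> col_map F, op_map = op_map G \<circ> op_map F\<rparr>"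

lemma operad_functor_comp:
  assumes "operad_functor P Q F" "operad_functor Q R G"
  shows "operad_functor P R (opd_map_comp F G)"
proof -
  interpret F: operad_functor P Q F by fact
  interpret G: operad_functor Q R G by fact
  show ?thesis
    by unfold_locales
      (auto simp: opd_map_comp_def F.col_in G.col_in F.op_in G.op_in F.map_Ins G.map_Ins F.map_Out
        G.map_Out F.map_Unit G.map_Unit F.map_Opcomp G.map_Opcomp[OF F.pluggable_map])
qed

section \<open>Corollas, and uniqueness of functors out of a free operad\<close>

definition corolla :: "('c, 'v) species \<Rightarrow> 'v \<Rightarrow> ('c, 'v) tree" where
  "corolla S x = Node x (map Leaf (Inputs S x))"

lemma leaves_corolla [simp]: "leaves (corolla S x) = Inputs S x"
  by (simp add: corolla_def comp_def)

lemma root_color_corolla [simp]: "root_color S (corolla S x) = Output S x"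
  by (simp add: corolla_def)

lemma (in wf_species) well_typed_corolla: "x \<in> Nodes S \<Longrightarrow> well_typed S (corolla S x)"
  using Inputs_in by (auto simp: corolla_def comp_def)

lemma grafts_Leaves: "length ts = length cs \<Longrightarrow> grafts (map Leaf cs) ts = ts"
  by (induction ts cs rule: list_induct2) auto

lemma graft_corolla:
  "length ts = length (Inputs S x) \<Longrightarrow> graft (corolla S x) ts = Node x ts"
  by (simp add: corolla_def grafts_Leaves)

lemma extend_op_corolla:
  assumes "operad P" "\<psi> x \<in> Ops P" "Ins P (\<psi> x) = map \<phi> (Inputs S x)"
  shows "extend_op P \<phi> \<psi> (corolla S x) = \<psi> x"
  using operad.Opcomp_Unit[OF assms(1,2)] assms(3) by (simp add: corolla_def comp_def)

text \<open>Grafting \<open>ts\<close> into the corolla of \<open>x\<close> gives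
  \<open>Node x ts\<close>, so preservation of composition reduces \<open>F\<close> to its values on
  corollas. Two functors out of a free operad can therefore be compared on colors and nodes
  alone.\<close>

lemma free_operad_functor_eq_extend_op:
  assumes "wf_species S" "operad_functor (free_operad S) P F" "well_typed S t"
  shows "op_map F t = extend_op P (col_map F) (\<lambda>x. op_map F (corolla S x)) t"
proof -
  interpret wf_species S by fact
  interpret F: operad_functor "free_operad S" P F by fact
  show ?thesis
    using assms(3)
  proof (induction t)
    case (Leaf R)
    then show ?case
      using F.map_Unit[of R] by (simp add: free_operad_def)
  next
    case (Node x ts)
    have "pluggable (free_operad S) (corolla S x) ts"
      using Node.prems well_typed_corolla by (auto simp: pluggable_def free_operad_def)
    then have "op_map F (graft (corolla S x) ts) =
        Opcomp P (op_map F (corolla S x)) (map (op_map F) ts)"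
      using F.map_Opcomp[of "corolla S x" ts] by (simp add: free_operad_def)
    moreover have "length ts = length (Inputs S x)"
      using Node.prems by (metis length_map well_typed.simps(2))
    moreover have "map (op_map F) ts =
        map (extend_op P (col_map F) (\<lambda>x. op_map F (corolla S x))) ts"
      using Node by auto
    ultimately show ?case
      by (simp add: graft_corolla)
  qed
qed

lemma extend_op_cong:
  assumes "well_typed S t" "\<And>x. x \<in> Nodes S \<Longrightarrow> \<psi> x = \<psi>' x"
  shows "extend_op P \<phi> \<psi> t = extend_op P \<phi> \<psi>' t"
  using assms(1) by (induction t) (auto simp: assms(2) intro!: arg_cong[where f = "Opcomp P _"])

text \<open>Recoloring a tree changes only its leaves, so it can be absorbed into the color map.
  This moves an evaluation from recolored trees back to trees over the original species.\<close>

lemma extend_op_map_tree: "extend_op P \<phi> \<psi> (map_tree f (\<lambda>v. v) t) = extend_op P (\<phi> \<circ> f) \<psi> t"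
  by (induction t) (auto simp: comp_def intro!: arg_cong[where f = "Opcomp P _"])


section \<open>Spliced arrows\<close>

lemma length_gaps [simp]: "length (gaps C ws) = length ws - 1"
  by (simp add: gaps_def)

lemma nth_gaps: "Suc i < length ws \<Longrightarrow> gaps C ws ! i = (Cod C (ws ! i), Dom C (ws ! Suc i))"
  by (simp add: gaps_def nth_butlast nth_tl)

context cat_functor
begin

lemma map_glue:
  assumes "src.spliced u" "src.spliced v" "Cod C (last u) = Dom C (hd v)"
  shows "map (arr_map F) (glue C u v) = glue D (map (arr_map F) u) (map (arr_map F) v)"
proof -
  have "last u \<in> Arr C" "hd v \<in> Arr C"
    using assms by (auto simp: src.spliced_def)
  then show ?thesis
    using assms
    by (auto simp: glue_def src.spliced_def map_butlast map_tl last_map hd_map map_Comp)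
qed

text \<open>Splicing only composes arrows at the two ends of each gap, and a functor preserves these
  composites. The assumption on \<open>ws\<close> and \<open>us\<close> makes every one of them
  composable.\<close>

lemma map_splice:
  assumes "src.fits ws us"
  shows "map (arr_map F) (splice C ws us) = splice D (map (arr_map F) ws) (map (map (arr_map F)) us)"
  using assms
proof (induction ws arbitrary: us)
  case Nil
  then show ?case by (simp add: src.fits_iff src.spliced_def)
next
  case (Cons w ws)
  show ?case
  proof (cases ws)
    case Nil
    then show ?thesis
      using Cons.prems by (auto simp: src.fits_single)
  next
    case (Cons v vs)
    then obtain u us' where u: "us = u # us'" "w \<in> Arr C" "src.spliced u" "Dom C (hd u) = Cod C w"
      "Cod C (last u) = Dom C v" "src.fits ws us'"
      using Cons.prems by (auto simp: src.fits_Cons)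
    have w: "src.spliced [w]"
      using u by (simp add: src.spliced_def)
    note g = src.glue_typed[OF w u(3)] and t = src.splice_typed[OF u(6)]
    have "map (arr_map F) (glue C (glue C [w] u) (splice C ws us')) =
        glue D (map (arr_map F) (glue C [w] u)) (map (arr_map F) (splice C ws us'))"
      by (rule map_glue) (use g t u Cons in \<open>simp_all del: glue_simps\<close>)
    also have "map (arr_map F) (glue C [w] u) = glue D [arr_map F w] (map (arr_map F) u)"
      using map_glue[OF w u(3)] u(4) by simp
    also note Cons.IH[OF u(6)]
    finally show ?thesis
      using u(1) by simp
  qed
qed

lemma map_gaps:
  "set ws \<subseteq> Arr C \<Longrightarrow> gaps D (map (arr_map F) ws) = map (map_prod (obj_map F) (obj_map F)) (gaps C ws)"
proof (induction ws)
  case (Cons w ws)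
  then show ?case by (cases ws) (auto simp: map_Dom map_Cod)
qed simp

end

text \<open>Spliced arrows are functorial in the category; this is the action on
  \<open>F\<close>.\<close>

definition spliced_functor ::
  "('o, 'a, 'p, 'b) cat_map \<Rightarrow> ('o \<times> 'o, 'a list, 'p \<times> 'p, 'b list) opd_map" where
  "spliced_functor F = \<lparr>col_map = map_prod (obj_map F) (obj_map F), op_map = map (arr_map F)\<rparr>"

lemma (in cat_functor) operad_functor_spliced_functor:
  "operad_functor (spliced_arrows C) (spliced_arrows D) (spliced_functor F)"
proof -
  interpret S: operad "spliced_arrows C" by (rule src.operad_spliced_arrows)
  interpret T: operad "spliced_arrows D" by (rule tgt.operad_spliced_arrows)
  show ?thesis
  proof
    fix ws us assume "src.fits ws us"
    from map_splice[OF this]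
    show "op_map (spliced_functor F) (Opcomp (spliced_arrows C) ws us) =
        Opcomp (spliced_arrows D) (op_map (spliced_functor F) ws) (map (op_map (spliced_functor F)) us)"
      by (simp add: spliced_functor_def spliced_arrows_def)
  next
    fix ws assume "ws \<in> Ops (spliced_arrows C)"
    then have ws: "ws \<noteq> []" "set ws \<subseteq> Arr C"
      by (auto simp: spliced_arrows_def)
    then have "hd ws \<in> Arr C" "last ws \<in> Arr C"
      by auto
    then show "Out (spliced_arrows D) (op_map (spliced_functor F) ws) =
        col_map (spliced_functor F) (Out (spliced_arrows C) ws)"
      using ws by (simp add: spliced_functor_def spliced_arrows_def hd_map last_map map_Dom map_Cod)
  qed (auto simp: spliced_functor_def spliced_arrows_def obj_in arr_in map_gaps map_Id)
qed


section \<open>Functors out of free categories\<close>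

text \<open>The evaluation given by the universal property of a free category. The fold ends in an
  identity at the target, so that empty paths have a value; a single edge \<open>e\<close> is sent
  to \<open>\<psi> e\<close> followed by an identity.\<close>

definition walk_functor ::
  "('p, 'b) cat \<Rightarrow> ('o \<Rightarrow> 'p) \<Rightarrow> ('e \<Rightarrow> 'b) \<Rightarrow> ('o, ('o, 'e) path, 'p, 'b) cat_map" where
  "walk_functor C \<phi> \<psi> = \<lparr>obj_map = \<phi>,
     arr_map = (\<lambda>f. foldr (\<lambda>e. Comp C (\<psi> e)) (path_edges f) (Id C (\<phi> (path_tgt f))))\<rparr>"

lemma cat_functor_walk_functor:
  assumes "category C"
    and src: "\<And>e. e \<in> Edges G \<Longrightarrow> Src G e \<in> Verts G"
    and \<phi>: "\<And>a. a \<in> Verts G \<Longrightarrow> \<phi> a \<in> Obj C"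
    and \<psi>: "\<And>e. e \<in> Edges G \<Longrightarrow> \<psi> e \<in> hom C (\<phi> (Src G e)) (\<phi> (Tgt G e))"
  shows "cat_functor (free_category G) C (walk_functor C \<phi> \<psi>)"
proof -
  interpret C: category C by fact
  interpret G: category "free_category G" by (rule category_free_category) (rule src)
  let ?ev = "\<lambda>es b. foldr (\<lambda>e. Comp C (\<psi> e)) es (Id C (\<phi> b))"
  have typed: "?ev es b \<in> hom C (\<phi> a) (\<phi> b)" if "is_walk G a es b" for a es b
    using that
  proof (induction es arbitrary: a)
    case Nil
    then show ?case by (auto simp: hom_def \<phi> C.Id_in C.Dom_Id C.Cod_Id)
  next
    case (Cons e es)
    then have "?ev es b \<in> hom C (\<phi> (Tgt G e)) (\<phi> b)" "\<psi> e \<in> hom C (\<phi> a) (\<phi> (Tgt G e))"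
      using \<psi>[of e] by auto
    then show ?case
      by (simp add: hom_def C.Comp_in C.Dom_Comp C.Cod_Comp)
  qed
  have comp: "?ev (es @ fs) c = Comp C (?ev es b) (?ev fs c)"
    if "is_walk G a es b" "is_walk G b fs c" for a b c es fs
    using that
  proof (induction es arbitrary: a)
    case Nil
    then show ?case
      using typed[of b fs c] C.Id_Comp[of "?ev fs c"] by (auto simp: hom_def)
  next
    case (Cons e es)
    have "?ev es b \<in> hom C (\<phi> (Tgt G e)) (\<phi> b)" "\<psi> e \<in> hom C (\<phi> a) (\<phi> (Tgt G e))"
      "?ev fs c \<in> hom C (\<phi> b) (\<phi> c)"
      using Cons.prems \<psi>[of e] typed by auto
    then show ?case
      using Cons.IH[of "Tgt G e"] Cons.prems by (simp add: hom_def C.Comp_assoc)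
  qed
  show ?thesis
    by unfold_locales
      (use typed comp in \<open>auto simp: walk_functor_def free_category_def hom_def \<phi>\<close>)
qed

section \<open>Relabelling the vertices of a graph as a finitary ULF functor\<close>

lemma is_walk_tgt_unique: "is_walk G a es b \<Longrightarrow> is_walk G a es c \<Longrightarrow> b = c"
  by (induction es arbitrary: a) auto

text \<open>The cut vertex is the target of the last edge of \<open>es\<close>, or \<open>a\<close>
  when \<open>es\<close> is empty; the first two assumptions make it a vertex in either
  case.\<close>

lemma is_walk_appendD:
  assumes "\<And>e. e \<in> Edges G \<Longrightarrow> Tgt G e \<in> Verts G" "a \<in> Verts G" "is_walk G a (es @ fs) c"
  obtains b where "is_walk G a es b" "is_walk G b fs c"
  using assms(2,3)
proof (induction es arbitrary: a thesis)
  case (Cons e es)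
  have "Tgt G e \<in> Verts G" "is_walk G (Tgt G e) (es @ fs) c"
    using Cons.prems assms(1) by auto
  then obtain b where "is_walk G (Tgt G e) es b" "is_walk G b fs c"
    using Cons.IH by blast
  then show ?case
    using Cons.prems by auto
qed simp

text \<open>A path stores only its end vertices besides its edges, so the intermediate vertices are
  relabelled implicitly, through \<open>Src\<close> and \<open>Tgt\<close> of the target
  graph.\<close>

definition relabel_functor :: "('o \<Rightarrow> 'p) \<Rightarrow> ('o, ('o, 'e) path, 'p, ('p, 'e) path) cat_map" where
  "relabel_functor f = \<lparr>obj_map = f,
     arr_map = (\<lambda>g. Path (f (path_src g)) (path_edges g) (f (path_tgt g)))\<rparr>"

locale graph_relabelling =
  fixes G :: "('o, 'e) graph" and H :: "('p, 'e) graph" and f :: "'o \<Rightarrow> 'p"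
  assumes Src_in: "e \<in> Edges G \<Longrightarrow> Src G e \<in> Verts G"
    and Tgt_in: "e \<in> Edges G \<Longrightarrow> Tgt G e \<in> Verts G"
    and Src_in': "e \<in> Edges H \<Longrightarrow> Src H e \<in> Verts H"
    and vert_in: "a \<in> Verts G \<Longrightarrow> f a \<in> Verts H"
    and edge_in: "e \<in> Edges G \<Longrightarrow> e \<in> Edges H"
    and map_Src: "e \<in> Edges G \<Longrightarrow> Src H e = f (Src G e)"
    and map_Tgt: "e \<in> Edges G \<Longrightarrow> Tgt H e = f (Tgt G e)"
begin

lemma is_walk_map: "is_walk G a es b \<Longrightarrow> is_walk H (f a) es (f b)"
  by (induction es arbitrary: a) (auto simp: vert_in edge_in map_Src map_Tgt)

lemma cat_functor_relabel: "cat_functor (free_category G) (free_category H) (relabel_functor f)"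
proof -
  interpret G: category "free_category G" by (rule category_free_category) (rule Src_in)
  interpret H: category "free_category H" by (rule category_free_category) (rule Src_in')
  show ?thesis
    by unfold_locales
      (use is_walk_map in \<open>auto simp: relabel_functor_def free_category_def vert_in\<close>)
qed

text \<open>Since edges are kept, a factorization of the image of \<open>\<alpha>\<close> says where
  to cut the edge list of \<open>\<alpha>\<close>. The vertex at the cut is determined by the source
  of \<open>\<alpha>\<close> and the edges before it, which gives uniqueness.\<close>

lemma ulf_relabel: "ulf (free_category G) (free_category H) (relabel_functor f)"
  unfolding ulf_def
proof (intro ballI impI)
  let ?G = "free_category G" and ?H = "free_category H" and ?p = "relabel_functor f"
  fix \<alpha> u v
  assume "\<alpha> \<in> Arr ?G" "u \<in> Arr ?H"
    and uv: "Cod ?H u = Dom ?H v \<and> arr_map ?p \<alpha> = Comp ?H u v"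
  obtain a es c where \<alpha>: "\<alpha> = Path a es c" "is_walk G a es c"
    using \<open>\<alpha> \<in> Arr ?G\<close> by (auto simp: free_category_def)
  obtain a' es1 m where u': "u = Path a' es1 m" "is_walk H a' es1 m"
    using \<open>u \<in> Arr ?H\<close> by (auto simp: free_category_def)
  obtain m' es2 c' where v': "v = Path m' es2 c'"
    by (cases v)
  have es: "es = es1 @ es2" "u = Path (f a) es1 m" "v = Path m es2 (f c)"
    and u: "is_walk H (f a) es1 m"
    using uv u'(2) unfolding \<alpha>(1) u'(1) v'
    by (simp_all add: free_category_def relabel_functor_def)
  have "a \<in> Verts G"
    using is_walk_verts[of G a es c] \<alpha>(2) Src_in by blast
  then obtain b where b: "is_walk G a es1 b" "is_walk G b es2 c"
    using is_walk_appendD[of G a es1 es2 c] Tgt_in \<alpha>(2) es(1) by blast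
  \<comment> \<open>Both vertices end a walk in \<open>H\<close> from \<open>f a\<close> along the
    same edges \<open>es1\<close>.\<close>
  have m: "m = f b"
    using is_walk_tgt_unique[OF u is_walk_map[OF b(1)]] .
  show "\<exists>!(\<beta>, \<gamma>). \<beta> \<in> Arr ?G \<and> \<gamma> \<in> Arr ?G \<and> Cod ?G \<beta> = Dom ?G \<gamma> \<and> \<alpha> = Comp ?G \<beta> \<gamma> \<and>
      arr_map ?p \<beta> = u \<and> arr_map ?p \<gamma> = v"
  proof (rule ex1I[of _ "(Path a es1 b, Path b es2 c)"])
    show "case (Path a es1 b, Path b es2 c) of (\<beta>, \<gamma>) \<Rightarrow>
        \<beta> \<in> Arr ?G \<and> \<gamma> \<in> Arr ?G \<and> Cod ?G \<beta> = Dom ?G \<gamma> \<and> \<alpha> = Comp ?G \<beta> \<gamma> \<and>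
        arr_map ?p \<beta> = u \<and> arr_map ?p \<gamma> = v"
      using b m \<alpha> es by (simp add: free_category_def relabel_functor_def)
  next
    fix bc
    assume "case bc of (\<beta>, \<gamma>) \<Rightarrow>
        \<beta> \<in> Arr ?G \<and> \<gamma> \<in> Arr ?G \<and> Cod ?G \<beta> = Dom ?G \<gamma> \<and> \<alpha> = Comp ?G \<beta> \<gamma> \<and>
        arr_map ?p \<beta> = u \<and> arr_map ?p \<gamma> = v"
    moreover obtain a1 e1 b1 a2 e2 b2 where bc: "bc = (Path a1 e1 b1, Path a2 e2 b2)"
      by (metis path.exhaust surj_pair)
    ultimately have "is_walk G a1 e1 b1" "b1 = a2" "a = a1" "c = b2" "e1 = es1" "e2 = es2"
      unfolding bc \<alpha>(1) es by (auto simp: free_category_def relabel_functor_def)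
    then show "bc = (Path a es1 b, Path b es2 c)"
      using bc is_walk_tgt_unique[of G a es1 b1 b] b(1) by simp
  qed
qed

text \<open>An arrow over \<open>w\<close> has the edges of \<open>w\<close>; only its two end
  vertices are left to choose.\<close>

lemma finitary_relabel:
  assumes "finite (Verts G)"
  shows "finitary (free_category G) (free_category H) (relabel_functor f)"
proof -
  have "finite {\<alpha> \<in> Arr (free_category G). arr_map (relabel_functor f) \<alpha> = w}" for w
  proof (rule finite_subset)
    show "{\<alpha> \<in> Arr (free_category G). arr_map (relabel_functor f) \<alpha> = w} \<subseteq>
        (\<lambda>(a, b). Path a (path_edges w) b) ` (Verts G \<times> Verts G)"
    proof
      fix \<alpha> assume "\<alpha> \<in> {\<alpha> \<in> Arr (free_category G). arr_map (relabel_functor f) \<alpha> = w}"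
      then obtain a b where "\<alpha> = Path a (path_edges w) b" "is_walk G a (path_edges w) b"
        by (auto simp: free_category_def relabel_functor_def)
      then show "\<alpha> \<in> (\<lambda>(a, b). Path a (path_edges w) b) ` (Verts G \<times> Verts G)"
        using is_walk_verts[of G a "path_edges w" b] Src_in by auto
    qed
  qed (simp add: assms)
  then show ?thesis
    using assms by (simp add: finitary_def free_category_def)
qed

end


section \<open>Contour words of closed trees\<close>

fun interleave :: "'v \<Rightarrow> nat \<Rightarrow> ('v \<times> nat) list list \<Rightarrow> ('v \<times> nat) list" where
  "interleave x i [] = [(x, i)]"
| "interleave x i (w # ws) = (x, i) # w @ interleave x (Suc i) ws"

text \<open>Recording edges without vertices makes the word independent of the coloring, so a tree
  and its recoloring share it. The empty word at a leaf is a default value; the contours considered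
  below are those of trees without leaves.\<close>

primrec contour_word :: "('c, 'v) tree \<Rightarrow> ('v \<times> nat) list" where
  "contour_word (Leaf R) = []"
| "contour_word (Node x ts) = interleave x 0 (map contour_word ts)"

lemma contour_word_map_tree: "contour_word (map_tree f (\<lambda>v. v) t) = contour_word t"
  by (induction t) (auto simp: comp_def intro!: arg_cong[where f = "interleave _ 0"])

lemma leaves_map_tree: "leaves (map_tree f (\<lambda>v. v) t) = map f (leaves t)"
  by (induction t) (auto simp: map_concat comp_def intro!: arg_cong[where f = concat])

text \<open>Without leaves there are no gaps, so the spliced arrow is a single path. Splicing the
  paths of the subtrees between the corners \<open>(x, 0)\<close>, ..., \<open>(x, n)\<close> of the
  root concatenates the edges as \<open>interleave\<close> does.\<close>

lemma contour_functor_closed: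
  assumes "well_typed S t" "leaves t = []"
  shows "op_map (contour_functor S) t =
    [Path (Up (root_color S t)) (contour_word t) (Down (root_color S t))]"
  using assms
proof (induction t)
  case (Node x ts)
  let ?e = "op_map (contour_functor S)" and ?C = "contour_category S" and ?G = "contour_graph S"
  define n where "n = length (Inputs S x)"
  \<comment> \<open>Generalized to the corners from \<open>i\<close> on, with \<open>us\<close>
    filling the remaining gaps, for induction on \<open>us\<close>; the case \<open>i = 0\<close> is
    the one wanted.\<close>
  have splice: "splice ?C (map (contour_gen S x) [i..<Suc n]) (map ?e us) =
      [Path (Src ?G (x, i)) (interleave x i (map contour_word us)) (Down (Output S x))]"
    if "i + length us = n"
      "\<forall>t\<in>set us. ?e t = [Path (Up (root_color S t)) (contour_word t) (Down (root_color S t))]"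
    for i us
    using that
  proof (induction us arbitrary: i)
    case Nil
    then show ?case
      by (simp add: contour_gen_def contour_graph_def n_def)
  next
    case (Cons u us)
    have "[i..<Suc n] = i # [Suc i..<Suc n]"
      using Cons.prems(1) by (simp add: upt_rec del: upt_Suc)
    moreover have "splice ?C (map (contour_gen S x) [Suc i..<Suc n]) (map ?e us) =
      [Path (Src ?G (x, Suc i)) (interleave x (Suc i) (map contour_word us)) (Down (Output S x))]"
      using Cons by simp
    ultimately have "splice ?C (map (contour_gen S x) [i..<Suc n]) (map ?e (u # us)) =
      glue ?C (glue ?C [contour_gen S x i]
          [Path (Up (root_color S u)) (contour_word u) (Down (root_color S u))])
        [Path (Src ?G (x, Suc i)) (interleave x (Suc i) (map contour_word us)) (Down (Output S x))]"
      using Cons.prems(2) by simp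
    also have "\<dots> = [Path (Src ?G (x, i)) (interleave x i (map contour_word (u # us))) (Down (Output S x))]"
      by (simp add: contour_category_def free_category_def contour_gen_def)
    finally show ?case .
  qed
  have "length ts = n"
    using Node.prems(1) unfolding n_def by (metis length_map well_typed.simps(2))
  then show ?case
    using splice[of 0 ts] Node
    by (auto simp: contour_functor_def free_extension_def spliced_arrows_def n_def
        contour_graph_def comp_def)
qed simp


section \<open>Recolored species\<close>

text \<open>The color set \<open>X\<close> is a parameter rather than the image of \<open>f\<close>,
  so that all pairs of objects can be colors even if no node mentions them.\<close>

definition recolor :: "('c \<Rightarrow> 'd) \<Rightarrow> 'd set \<Rightarrow> ('c, 'v) species \<Rightarrow> ('d, 'v) species" where
  "recolor f X S = \<lparr>Colors = X, Nodes = Nodes S, Inputs = map f \<circ> Inputs S, Output = f \<circ> Output S\<rparr>"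

lemma recolor_simps [simp]:
  "Colors (recolor f X S) = X" "Nodes (recolor f X S) = Nodes S"
  "Inputs (recolor f X S) x = map f (Inputs S x)" "Output (recolor f X S) x = f (Output S x)"
  by (simp_all add: recolor_def)

lemma root_color_recolor: "root_color (recolor f X S) (map_tree f (\<lambda>v. v) t) = f (root_color S t)"
  by (cases t) auto

locale species_recoloring = finite_species S for S :: "('c, 'v) species" +
  fixes f :: "'c \<Rightarrow> 'd" and X :: "'d set"
  assumes finite_X: "finite X" and color_in: "R \<in> Colors S \<Longrightarrow> f R \<in> X"
begin

lemma finite_species_recolor: "finite_species (recolor f X S)"
  using Inputs_in Output_in color_in
  by unfold_locales (auto simp: finite_X finite_Nodes)

lemma well_typed_recolor: "well_typed S t \<Longrightarrow> well_typed (recolor f X S) (map_tree f (\<lambda>v. v) t)"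
proof (induction t)
  case (Node x ts)
  have "map (\<lambda>t. root_color (recolor f X S) (map_tree f (\<lambda>v. v) t)) ts = map f (map (root_color S) ts)"
    by (simp add: root_color_recolor)
  also have "\<dots> = map f (Inputs S x)"
    using Node.prems by simp
  finally show ?case
    using Node by (auto simp: comp_def)
qed (simp add: color_in)

lemma graph_relabelling_contour:
  "graph_relabelling (contour_graph S) (contour_graph (recolor f X S)) (map_contour_obj f)"
proof -
  interpret R: finite_species "recolor f X S" by (rule finite_species_recolor)
  show ?thesis
  proof
    fix a assume "a \<in> Verts (contour_graph S)"
    then show "map_contour_obj f a \<in> Verts (contour_graph (recolor f X S))"
      by (auto simp: contour_graph_def color_in)
  qed (use contour_Src_in contour_Tgt_in R.contour_Src_in in
      \<open>auto simp: contour_graph_def split: if_splits\<close>)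
qed

text \<open>The states over a vertex of the recolored contour graph are the original colors, tagged
  \<open>Up\<close> or \<open>Down\<close>, that \<open>f\<close> sends to its color. They are
  finitely many because \<open>Colors S\<close> is finite.\<close>

lemma automaton_recolor:
  assumes "s \<in> Colors S"
  shows "finite_state_automaton (contour_category (recolor f X S)) (contour_category S)
    (relabel_functor (map_contour_obj f)) (Up s) (Down s)"
proof -
  interpret graph_relabelling "contour_graph S" "contour_graph (recolor f X S)" "map_contour_obj f"
    by (rule graph_relabelling_contour)
  have "finite (Verts (contour_graph S))"
    by (simp add: contour_graph_def finite_Colors)
  moreover have "Up s \<in> Obj (contour_category S)" "Down s \<in> Obj (contour_category S)"
    using assms by (auto simp: contour_category_def free_category_def contour_graph_def)
  ultimately show ?thesis
    using cat_functor_relabel ulf_relabel finitary_relabel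
    by (simp add: finite_state_automaton_def contour_category_def)
qed

text \<open>A nonleaf tree with root node \<open>y\<close> has a word beginning with
  \<open>(y, 0)\<close>, whose source in the graph of \<open>S\<close> is
  \<open>Up (Output S y)\<close>. The walk can thus enter a subtree only if its root has the
  \<open>S\<close>-color that the parent node expects there. The tail \<open>es\<close> is what
  remains to be walked after the tree, which lets the induction hypothesis apply to a subtree inside
  a larger walk.\<close>

lemma contour_walk_lift:
  assumes "well_typed (recolor f X S) t'" "leaves t' = []"
    and "is_walk (contour_graph S) a (contour_word t' @ es) b"
  shows "\<exists>t. t' = map_tree f (\<lambda>v. v) t \<and> well_typed S t \<and> leaves t = [] \<and> a = Up (root_color S t) \<and>
    is_walk (contour_graph S) (Down (root_color S t)) es b"
  using assms
proof (induction t' arbitrary: a es)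
  case (Node x ts')
  let ?G = "contour_graph S"
  define n where "n = length (Inputs S x)"
  have x: "x \<in> Nodes S"
    using Node.prems(1) by simp
  \<comment> \<open>The same claim for the children from position \<open>i\<close> on: after each
    child the walk stands at a \<open>Down\<close> vertex, from which the next corner of
    \<open>x\<close> continues.\<close>
  have children: "\<exists>ts. us = map (map_tree f (\<lambda>v. v)) ts \<and> (\<forall>t\<in>set ts. well_typed S t \<and> leaves t = []) \<and>
      map (root_color S) ts = drop i (Inputs S x) \<and> a = Src ?G (x, i) \<and>
      is_walk ?G (Down (Output S x)) es b"
    if "i + length us = n" "set us \<subseteq> set ts'"
      "is_walk ?G a (interleave x i (map contour_word us) @ es) b" for us i a
    using that
  proof (induction us arbitrary: i a)
    case Nil
    then show ?case
      by (auto simp: n_def contour_graph_def)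
  next
    case (Cons u us)
    have i: "i < n"
      using Cons.prems(1) by simp
    have u: "u \<in> set ts'" "well_typed (recolor f X S) u" "leaves u = []"
      using Cons.prems(2) Node.prems(1,2) by auto
    have a: "a = Src ?G (x, i)"
      and "is_walk ?G (Tgt ?G (x, i)) (contour_word u @ interleave x (Suc i) (map contour_word us) @ es) b"
      using Cons.prems(3) by auto
    then obtain t where t: "u = map_tree f (\<lambda>v. v) t" "well_typed S t" "leaves t = []"
      "Tgt ?G (x, i) = Up (root_color S t)"
      "is_walk ?G (Down (root_color S t)) (interleave x (Suc i) (map contour_word us) @ es) b"
      using Node.IH[OF u] by blast
    \<comment> \<open>As \<open>i < n\<close>, the corner \<open>(x, i)\<close> ends at
      \<open>Up\<close> of the \<open>i\<close>-th input color, and \<open>Up\<close> is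
      injective.\<close>
    have "root_color S t = Inputs S x ! i"
      using t(4) i by (simp add: contour_graph_def n_def)
    moreover obtain ts where "us = map (map_tree f (\<lambda>v. v)) ts" "\<forall>t\<in>set ts. well_typed S t \<and> leaves t = []"
      "map (root_color S) ts = drop (Suc i) (Inputs S x)" "is_walk ?G (Down (Output S x)) es b"
      using Cons.IH[of "Suc i", OF _ _ t(5)] Cons.prems(1,2) by auto
    ultimately show ?case
      using t a i by (intro exI[of _ "t # ts"]) (auto simp: n_def Cons_nth_drop_Suc)
  qed
  have "length ts' = n"
    using Node.prems(1) unfolding n_def
    by (metis length_map recolor_simps(3) well_typed.simps(2))
  then obtain ts where "ts' = map (map_tree f (\<lambda>v. v)) ts" "\<forall>t\<in>set ts. well_typed S t \<and> leaves t = []"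
    "map (root_color S) ts = Inputs S x" "a = Src ?G (x, 0)" "is_walk ?G (Down (Output S x)) es b"
    using children[of 0 ts' a] Node.prems(3) by auto
  then show ?case
    using x by (intro exI[of _ "Node x ts"]) (auto simp: contour_graph_def)
qed simp

end


section \<open>The factorization of a grammar\<close>

text \<open>With this choice the corner \<open>(x, i)\<close> of the recolored species gets the type
  of the \<open>i\<close>-th arrow of the spliced arrow that \<open>p\<close> assigns to
  \<open>x\<close>.\<close>

fun contour_endpoint :: "('o \<times> 'o) contour_obj \<Rightarrow> 'o" where
  "contour_endpoint (Up (A, B)) = A"
| "contour_endpoint (Down (A, B)) = B"

definition grammar_realization ::
  "('o, 'a) cat \<Rightarrow> ('c, 'v) species \<Rightarrow> ('c, ('c, 'v) tree, 'o \<times> 'o, 'a list) opd_map \<Rightarrow>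
    (('o \<times> 'o) contour_obj, ('o \<times> 'o, 'v) contour_arrow, 'o, 'a) cat_map" where
  "grammar_realization C S p =
     walk_functor C contour_endpoint (\<lambda>(x, i). op_map p (corolla S x) ! i)"

locale grammar =
  fixes C :: "('o, 'a) cat"
    and S :: "('c, 'v) species"
    and s :: 'c
    and p :: "('c, ('c, 'v) tree, 'o \<times> 'o, 'a list) opd_map"
  assumes grammar: "context_free_grammar C S s p"
begin

sublocale category C
  using grammar by (simp add: context_free_grammar_def)

sublocale p: operad_functor "free_operad S" "spliced_arrows C" p
  using grammar by (simp add: context_free_grammar_def)

sublocale species_recoloring S "col_map p" "Obj C \<times> Obj C"
proof -
  interpret finite_species S
    using grammar by (simp add: context_free_grammar_def)
  show "species_recoloring S (col_map p) (Obj C \<times> Obj C)"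
    using grammar p.col_in
    by unfold_locales
      (auto simp: context_free_grammar_def finitely_generated_def free_operad_def spliced_arrows_def)
qed

abbreviation "R \<equiv> recolor (col_map p) (Obj C \<times> Obj C) S"
abbreviation "q \<equiv> grammar_realization C S p"

sublocale R: finite_species R
  by (rule finite_species_recolor)

lemma corolla_image:
  assumes "x \<in> Nodes S"
  shows "length (op_map p (corolla S x)) = Suc (length (Inputs S x))"
    and "set (op_map p (corolla S x)) \<subseteq> Arr C"
    and "gaps C (op_map p (corolla S x)) = map (col_map p) (Inputs S x)"
    and "(Dom C (hd (op_map p (corolla S x))), Cod C (last (op_map p (corolla S x)))) =
      col_map p (Output S x)"
proof -
  let ?w = "op_map p (corolla S x)"
  have t: "corolla S x \<in> Ops (free_operad S)"
    using assms well_typed_corolla by (simp add: free_operad_def)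
  have w: "?w \<noteq> []" "set ?w \<subseteq> Arr C"
    using p.op_in[OF t] by (auto simp: spliced_arrows_def)
  have g: "gaps C ?w = map (col_map p) (Inputs S x)"
    using p.map_Ins[OF t] by (simp add: spliced_arrows_def free_operad_def)
  have "length ?w - 1 = length (Inputs S x)"
    using arg_cong[OF g, of length] by simp
  then show "length ?w = Suc (length (Inputs S x))"
    using w(1) by (cases ?w) auto
  show "set ?w \<subseteq> Arr C" "gaps C ?w = map (col_map p) (Inputs S x)"
    by fact+
  show "(Dom C (hd ?w), Cod C (last ?w)) = col_map p (Output S x)"
    using p.map_Out[OF t] by (simp add: spliced_arrows_def free_operad_def)
qed

text \<open>Arrow \<open>i\<close> lies between gap \<open>i - 1\<close> and gap \<open>i\<close>,
  whose colors give its two ends. At \<open>i = 0\<close> and at the last position the outer end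
  comes from the output color instead.\<close>

lemma corolla_image_nth:
  assumes "(x, i) \<in> Edges (contour_graph R)"
  shows "op_map p (corolla S x) ! i \<in> hom C
    (contour_endpoint (Src (contour_graph R) (x, i))) (contour_endpoint (Tgt (contour_graph R) (x, i)))"
proof -
  let ?w = "op_map p (corolla S x)" and ?I = "Inputs S x"
  have x: "x \<in> Nodes S" "i \<le> length ?I"
    using assms by (auto simp: contour_graph_def)
  note w = corolla_image[OF x(1)]
  have ne: "?w \<noteq> []"
    using w(1) by auto
  have up: "contour_endpoint (Up c) = fst c" and down: "contour_endpoint (Down c) = snd c"
    for c :: "'o \<times> 'o"
    by (cases c; simp)+
  have gap: "col_map p (?I ! j) = (Cod C (?w ! j), Dom C (?w ! Suc j))" if "j < length ?I" for j
    using nth_gaps[of j ?w C] w(1,3) that by simp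
  have out: "col_map p (Output S x) = (Dom C (?w ! 0), Cod C (?w ! length ?I))"
    using w(1,4) ne by (simp add: hd_conv_nth last_conv_nth)
  have "?w ! i \<in> Arr C"
    using w(1,2) x(2) by (auto intro!: subsetD[OF w(2)] nth_mem)
  moreover have "Dom C (?w ! i) = contour_endpoint (Src (contour_graph R) (x, i))"
    using x(2) gap[of "i - 1"] out
    by (cases i) (auto simp: contour_graph_def up down)
  moreover have "Cod C (?w ! i) = contour_endpoint (Tgt (contour_graph R) (x, i))"
    using x(2) gap[of i] out by (auto simp: contour_graph_def up down)
  ultimately show ?thesis
    by (simp add: hom_def)
qed

lemma cat_functor_realization: "cat_functor (contour_category R) C q"
  unfolding grammar_realization_def contour_category_def
proof (rule cat_functor_walk_functor)
  show "category C"
    by unfold_locales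
  fix a assume "a \<in> Verts (contour_graph R)"
  then show "contour_endpoint a \<in> Obj C"
    by (auto simp: contour_graph_def)
next
  fix e assume "e \<in> Edges (contour_graph R)"
  then show "(case e of (x, i) \<Rightarrow> op_map p (corolla S x) ! i) \<in> hom C
      (contour_endpoint (Src (contour_graph R) e)) (contour_endpoint (Tgt (contour_graph R) e))"
    using corolla_image_nth by (cases e) simp
qed (rule R.contour_Src_in)

lemma realization_contour_gens:
  assumes "x \<in> Nodes S"
  shows "map (arr_map q) (map (contour_gen R x) [0..<Suc (length (Inputs R x))]) =
    op_map p (corolla S x)"
proof (rule nth_equalityI)
  fix i assume "i < length (map (arr_map q) (map (contour_gen R x) [0..<Suc (length (Inputs R x))]))"
  then have i: "i < Suc (length (Inputs S x))"
    by (simp del: upt_Suc)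
  then have "(x, i) \<in> Edges (contour_graph R)"
    using assms by (simp add: contour_graph_def)
  \<comment> \<open>Evaluating a one-edge path leaves a trailing identity, which
    \<open>Comp_Id\<close> removes.\<close>
  from corolla_image_nth[OF this]
  have "arr_map q (contour_gen R x i) = op_map p (corolla S x) ! i"
    using Comp_Id[of "op_map p (corolla S x) ! i"]
    by (simp add: grammar_realization_def walk_functor_def contour_gen_def hom_def)
  then show "map (arr_map q) (map (contour_gen R x) [0..<Suc (length (Inputs R x))]) ! i =
      op_map p (corolla S x) ! i"
    using i by (simp del: upt_Suc)
qed (simp add: corolla_image(1)[OF assms])

lemma operad_functor_contour:
  "operad_functor (free_operad R) (spliced_arrows (contour_category R)) (contour_functor R)"
proof -
  have "s \<in> Colors S"
    using grammar by (simp add: context_free_grammar_def)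
  then have "col_map p s \<in> Colors R"
    using color_in by simp
  from context_free_grammar_contour[OF R.finite_species_axioms this] show ?thesis
    by (simp add: context_free_grammar_def)
qed

text \<open>This is the factorization of \<open>p\<close>. The composite \<open>?F\<close> and
  \<open>p\<close> agree on corollas, hence, by uniqueness of extensions, on all trees, once the
  recoloring is absorbed into the color map.\<close>

lemma realization_contour:
  assumes "well_typed S t"
  shows "map (arr_map q) (op_map (contour_functor R) (map_tree (col_map p) (\<lambda>v. v) t)) = op_map p t"
proof -
  let ?cR = "contour_functor R" and ?t' = "map_tree (col_map p) (\<lambda>v. v) t"
  let ?F = "opd_map_comp ?cR (spliced_functor q)"
  interpret q: cat_functor "contour_category R" C q
    by (rule cat_functor_realization)
  interpret c: operad_functor "free_operad R" "spliced_arrows (contour_category R)" ?cR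
    by (rule operad_functor_contour)
  have F: "operad_functor (free_operad R) (spliced_arrows C) ?F"
    using operad_functor_contour q.operad_functor_spliced_functor by (rule operad_functor_comp)
  \<comment> \<open>A color \<open>c\<close> goes to \<open>(Up c, Down c)\<close>, and
    \<open>contour_endpoint\<close> recovers the two components of \<open>c\<close>.\<close>
  have col: "col_map ?F = id"
    by (auto simp: opd_map_comp_def spliced_functor_def contour_functor_def free_extension_def
        grammar_realization_def walk_functor_def)
  have cor: "op_map ?F (corolla R x) = op_map p (corolla S x)" if "x \<in> Nodes S" for x
  proof -
    let ?w = "map (contour_gen R x) [0..<Suc (length (Inputs R x))]"
    have "gaps (contour_category R) ?w = map (\<lambda>c. (Up c, Down c)) (Inputs R x)"
      by (rule nth_equalityI)
        (auto simp: nth_gaps contour_gen_def contour_category_def free_category_def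
          contour_graph_def simp del: upt_Suc)
    moreover have "?w \<in> Ops (spliced_arrows (contour_category R))"
      using R.contour_gen_in[of x] that by (auto simp: spliced_arrows_def)
    ultimately have "op_map ?cR (corolla R x) = ?w"
      using extend_op_corolla[OF q.src.operad_spliced_arrows, of
          "\<lambda>x. map (contour_gen R x) [0..<Suc (length (Inputs R x))]" x "\<lambda>c. (Up c, Down c)" R]
      by (simp add: contour_functor_def free_extension_def spliced_arrows_def del: upt_Suc)
    then show ?thesis
      using realization_contour_gens[OF that]
      by (simp add: opd_map_comp_def spliced_functor_def del: upt_Suc)
  qed
  have "op_map ?F ?t' = extend_op (spliced_arrows C) id (\<lambda>x. op_map ?F (corolla R x)) ?t'"
    using free_operad_functor_eq_extend_op[OF R.wf_species_axioms F] well_typed_recolor[OF assms] col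
    by simp
  also have "\<dots> = extend_op (spliced_arrows C) (col_map p) (\<lambda>x. op_map ?F (corolla R x)) t"
    by (simp add: extend_op_map_tree)
  also have "\<dots> = extend_op (spliced_arrows C) (col_map p) (\<lambda>x. op_map p (corolla S x)) t"
    using assms cor by (rule extend_op_cong)
  also have "\<dots> = op_map p t"
    using free_operad_functor_eq_extend_op[OF wf_species_axioms p.operad_functor_axioms assms] ..
  finally show ?thesis
    by (simp add: opd_map_comp_def spliced_functor_def)
qed

section \<open>Comparison of the two languages\<close>

lemma closed_contour_in:
  assumes "finite_species T" "well_typed T t" "leaves t = []"
  shows "Path (Up (root_color T t)) (contour_word t) (Down (root_color T t)) \<in>
    Arr (contour_category T)"
proof -
  have "root_color T t \<in> Colors T"
    using assms(1,2) by (simp add: finite_species.axioms(1) wf_species.root_in)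
  then have "context_free_grammar (contour_category T) T (root_color T t) (contour_functor T)"
    by (rule context_free_grammar_contour[OF assms(1)])
  then interpret c: operad_functor "free_operad T" "spliced_arrows (contour_category T)"
    "contour_functor T"
    by (simp add: context_free_grammar_def)
  show ?thesis
    using c.op_in[of t] contour_functor_closed[OF assms(2,3)] assms(2)
    by (simp add: free_operad_def spliced_arrows_def)
qed

lemma language_eq:
  "grammar_language C S s p = arr_map q ` (tree_contour_language R (col_map p s) \<inter>
    automaton_language (contour_category S) (relabel_functor (map_contour_obj (col_map p))) (Up s) (Down s))"
    (is "_ = arr_map q ` (?T \<inter> ?A)")
proof (intro equalityI subsetI)
  fix w assume "w \<in> grammar_language C S s p"
  then obtain t where t: "well_typed S t" "leaves t = []" "root_color S t = s" "op_map p t = [w]"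
    by (auto simp: grammar_language_def constants_def free_operad_def)
  let ?t' = "map_tree (col_map p) (\<lambda>v. v) t"
  \<comment> \<open>The contour of \<open>t\<close> in \<open>S\<close> is an accepting run over the
    contour \<open>?\<alpha>'\<close> of the recolored tree: the edges are the same, and only the
    end vertices differ.\<close>
  let ?\<alpha> = "Path (Up s) (contour_word t) (Down s)"
  let ?\<alpha>' = "Path (Up (col_map p s)) (contour_word t) (Down (col_map p s))"
  have t': "well_typed R ?t'" "leaves ?t' = []" "root_color R ?t' = col_map p s"
    using t well_typed_recolor by (simp_all add: leaves_map_tree root_color_recolor)
  have c: "op_map (contour_functor R) ?t' = [?\<alpha>']"
    using contour_functor_closed[OF t'(1,2)] t'(3) by (simp add: contour_word_map_tree)
  have "?\<alpha>' \<in> ?T"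
    using closed_contour_in[OF R.finite_species_axioms t'(1,2)] t' c
    by (auto simp: tree_contour_language_def grammar_language_def constants_def free_operad_def
        contour_word_map_tree)
  moreover have "?\<alpha> \<in> hom (contour_category S) (Up s) (Down s)"
    using closed_contour_in[OF finite_species_axioms t(1,2)] t(3)
    by (simp add: hom_def contour_category_def free_category_def)
  then have "?\<alpha>' \<in> ?A"
    unfolding automaton_language_def
    by (rule rev_image_eqI) (simp add: relabel_functor_def)
  moreover have "arr_map q ?\<alpha>' = w"
    using realization_contour[OF t(1)] c t(4) by simp
  ultimately show "w \<in> arr_map q ` (?T \<inter> ?A)"
    by blast
next
  fix w assume "w \<in> arr_map q ` (?T \<inter> ?A)"
  then obtain \<beta> where \<beta>: "w = arr_map q \<beta>" "\<beta> \<in> ?T" "\<beta> \<in> ?A"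
    by blast
  from \<beta>(2) obtain t' where t': "well_typed R t'" "leaves t' = []"
      "op_map (contour_functor R) t' = [\<beta>]" "\<beta> \<in> Arr (contour_category R)"
    by (auto simp: tree_contour_language_def grammar_language_def constants_def free_operad_def)
  have "path_edges \<beta> = contour_word t'"
    using contour_functor_closed[OF t'(1,2)] t'(3) by simp
  moreover from \<beta>(3) obtain es where "is_walk (contour_graph S) (Up s) es (Down s)" "path_edges \<beta> = es"
    by (auto simp: automaton_language_def hom_def contour_category_def free_category_def
        relabel_functor_def)
  ultimately have "is_walk (contour_graph S) (Up s) (contour_word t' @ []) (Down s)"
    by simp
  \<comment> \<open>The run of the automaton over \<open>\<beta>\<close> supplies the missing
    \<open>S\<close>-coloring of \<open>t'\<close>, and its start at \<open>Up s\<close> forces the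
    root color \<open>s\<close>.\<close>
  then obtain t where t: "t' = map_tree (col_map p) (\<lambda>v. v) t" "well_typed S t" "leaves t = []"
      "root_color S t = s"
    using contour_walk_lift[OF t'(1,2)] by blast
  interpret q: cat_functor "contour_category R" C q
    by (rule cat_functor_realization)
  have "op_map p t = [w]"
    using realization_contour[OF t(2)] t(1) t'(3) \<beta>(1) by simp
  then show "w \<in> grammar_language C S s p"
    using t q.arr_in[OF t'(4)] \<beta>(1)
    by (auto simp: grammar_language_def constants_def free_operad_def)
qed

end

theorem theorem4p13:
  fixes C :: "('o, 'a) cat"
    and S :: "('c, 'v) species"
    and s :: 'c
    and p :: "('c, ('c, 'v) tree, 'o \<times> 'o, 'a list) opd_map"
    and A B :: 'o
    and L :: "'a set"
  assumes "category C"
    and "finitely_generated C"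
    and "context_free_grammar C S s p"
    and "col_map p s = (A, B)"
    and "L = grammar_language C S s p"
  shows "\<exists>(R :: ('o \<times> 'o, 'v) species) s'
            (Q :: ('c contour_obj, ('c, 'v) contour_arrow) cat) \<pi> q0 qf
            (q :: (('o \<times> 'o) contour_obj, ('o \<times> 'o, 'v) contour_arrow, 'o, 'a) cat_map).
          finite_species R \<and> Colors R = Obj C \<times> Obj C \<and> s' \<in> Colors R \<and>
          finite_state_automaton (contour_category R) Q \<pi> q0 qf \<and>
          cat_functor (contour_category R) C q \<and>
          L = arr_map q ` (tree_contour_language R s' \<inter> automaton_language Q \<pi> q0 qf)"
proof -
  interpret grammar C S s p
    using assms(3) by unfold_locales
  have s: "s \<in> Colors S"
    using assms(3) by (simp add: context_free_grammar_def)
  then have "col_map p s \<in> Colors R"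
    using color_in by simp
  \<comment> \<open>The witnesses are \<open>R\<close>, the color \<open>col_map p s\<close>, the
    automaton given by the contour category of \<open>S\<close> with states \<open>Up s\<close> and
    \<open>Down s\<close>, and the functor \<open>q\<close>.\<close>
  then show ?thesis
    unfolding assms(5)
    using R.finite_species_axioms automaton_recolor[OF s] cat_functor_realization language_eq
    by (metis recolor_simps(1))
qed

end
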